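(* Let $\mathcal{K}$ be the triadic (middle-third) Cantor set, $\gamma=\log_3 2$, and $\mu$ the standard Cantor measure on $\mathcal{K}$. Let $\psi:\mathbb{R}^+\to\mathbb{R}^+$ be a non-increasing positive function and define $$\mathcal{W}_{\mathrm{int},\mathcal{K}}(\psi)=\Big\{x\in\mathcal{K}: |x-p/q|<\psi(q_{\mathrm{int}}) \text{ for infinitely many rationals } p/q\in\mathcal{K}\Big\},$$ where $q_{\mathrm{int}}$ is the intrinsic denominator of $p/q$ (defined in the context). Then $$\mu\big(\mathcal{W}_{\mathrm{int},\mathcal{K}}(\psi)\big)=\begin{cases}0, & \text{if } \sum_{n\ge1} n\big(3^n\psi(3^n)\big)^{\gamma}<\infty,\\ 1, & \text{if } \sum_{n\ge1} n\big(3^n\psi(3^n)\big)^{\gamma}=\infty.\end{cases}$$ Consequently, if $f$ is a dimension function such that $f(r)/r^{\gamma}$ is non-decreasing, then $$\mathcal{H}^f\big(\mathcal{W}_{\mathrm{int},\mathcal{K}}(\psi)\big)=\begin{cases}\mathcal{H}^f(\mathcal{K}), & \text{if } \sum_{n\ge1} n\,3^{n\gamma} f(\psi(3^n))=\infty,\\ 0, & \text{otherwise},\end{cases}$$ where $\mathcal{H}^f$ denotes the $f$-Hausdorff measure.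
   Context: Every $x\in\mathcal{K}$ has a unique 3-adic expansion $x=\sum_{i\ge1}\epsilon_i3^{-i}$ with all digits $\epsilon_i\in\{0,2\}$. The Cantor measure $\mu$ is the probability measure on $\mathcal{K}$ giving mass $2^{-n}$ to each set of points of $\mathcal{K}$ whose expansion begins with a prescribed block $(\epsilon_1,\dots,\epsilon_n)\in\{0,2\}^n$. For a rational $p/q\in\mathcal{K}$ with digit sequence $(\epsilon_i)_{i\ge1}$ (which is ultimately periodic), let the prelength $\ell\ge0$ be the smallest integer such that $(\epsilon_i)_{i>\ell}$ is purely periodic, and let the period $m\ge1$ be the smallest period of $(\epsilon_i)_{i>\ell}$. The intrinsic denominator of $p/q$ is $q_{\mathrm{int}}=3^{\ell}(3^m-1)$. A dimension function is a continuous non-decreasing $f:\mathbb{R}^+\to\mathbb{R}^+$ with $f(r)\to0$ as $r\to0$. *)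

theory Defs
  imports "HOL-Probability.Probability"
begin

primrec cantor_stage :: "nat \<Rightarrow> real set" where
  "cantor_stage 0 = {0..1}"
| "cantor_stage (Suc n) = (\<lambda>x. x / 3) ` cantor_stage n \<union> (\<lambda>x. (2 + x) / 3) ` cantor_stage n"

definition cantor_set :: "real set" where
  "cantor_set = (\<Inter>n. cantor_stage n)"

text \<open>
  Digit sequences are indexed from 0: \<open>\<epsilon> i\<close> is the digit of weight \<open>3\<^sup>-\<^sup>(\<^sup>i\<^sup>+\<^sup>1\<^sup>)\<close>.
\<close>

definition cantor_expansion :: "real \<Rightarrow> (nat \<Rightarrow> nat) \<Rightarrow> bool" where
  "cantor_expansion x \<epsilon> \<longleftrightarrow>
     (\<forall>i. \<epsilon> i \<in> {0, 2}) \<and> (\<lambda>i. real (\<epsilon> i) / 3 ^ Suc i) sums x"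

definition cantor_digits :: "real \<Rightarrow> nat \<Rightarrow> nat" where
  "cantor_digits x = (THE \<epsilon>. cantor_expansion x \<epsilon>)"

lemma cantor_expansion_shift:
  assumes "cantor_expansion x \<epsilon>"
  shows "cantor_expansion (3 * x - real (\<epsilon> 0)) (\<lambda>i. \<epsilon> (Suc i))"
proof -
  have "(\<lambda>i. real (\<epsilon> i) / 3 ^ Suc i) sums x"
    using assms by (simp add: cantor_expansion_def)
  hence "(\<lambda>i. real (\<epsilon> (Suc i)) / 3 ^ Suc (Suc i)) sums (x - real (\<epsilon> 0) / 3)"
    by (subst sums_Suc_iff) simp
  hence "(\<lambda>i. 3 * (real (\<epsilon> (Suc i)) / 3 ^ Suc (Suc i))) sums (3 * (x - real (\<epsilon> 0) / 3))"
    by (rule sums_mult)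
  thus ?thesis
    using assms by (simp add: cantor_expansion_def right_diff_distrib)
qed

lemma cantor_expansion_bounds:
  assumes "cantor_expansion x \<epsilon>"
  shows "0 \<le> x" "x \<le> 1"
proof -
  have s: "(\<lambda>i. real (\<epsilon> i) / 3 ^ Suc i) sums x" and d: "\<epsilon> i \<in> {0, 2}" for i
    using assms by (auto simp: cantor_expansion_def)
  show "0 \<le> x"
    by (rule sums_le[OF _ sums_zero s]) simp
  have "(\<lambda>i. (2/3) * (1/3::real) ^ i) sums ((2/3) * (1 / (1 - 1/3)))"
    by (intro sums_mult geometric_sums) simp
  hence g: "(\<lambda>i. (2/3) * (1/3::real) ^ i) sums 1" by simp
  have "real (\<epsilon> i) / 3 ^ Suc i \<le> (2/3) * (1/3) ^ i" for i
    using d[of i] by (auto simp: power_one_over field_simps)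
  thus "x \<le> 1" by (rule sums_le[OF _ s g])
qed

lemma cantor_expansion_unique:
  assumes "cantor_expansion x \<epsilon>" "cantor_expansion x \<delta>"
  shows "\<epsilon> = \<delta>"
proof
  fix n
  have head: "\<epsilon> 0 = \<delta> 0" if "cantor_expansion x \<epsilon>" "cantor_expansion x \<delta>" for x \<epsilon> \<delta>
  proof -
    have "\<epsilon> 0 \<in> {0, 2}" "\<delta> 0 \<in> {0, 2}"
      using that by (auto simp: cantor_expansion_def)
    thus ?thesis
      using cantor_expansion_bounds[OF cantor_expansion_shift[OF that(1)]]
            cantor_expansion_bounds[OF cantor_expansion_shift[OF that(2)]] by auto
  qed
  show "\<epsilon> n = \<delta> n" using assms
  proof (induction n arbitrary: x \<epsilon> \<delta>)
    case 0
    thus ?case by (rule head)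
  next
    case (Suc n)
    have "cantor_expansion (3 * x - real (\<epsilon> 0)) (\<lambda>i. \<delta> (Suc i))"
      using cantor_expansion_shift[OF Suc.prems(2)] head[OF Suc.prems] by simp
    from Suc.IH[OF cantor_expansion_shift[OF Suc.prems(1)] this] show ?case .
  qed
qed

lemma cantor_expansion_in_cantor_set:
  assumes "cantor_expansion x \<epsilon>"
  shows "x \<in> cantor_set"
proof -
  have "x \<in> cantor_stage n" for n using assms
  proof (induction n arbitrary: x \<epsilon>)
    case 0
    thus ?case using cantor_expansion_bounds by auto
  next
    case (Suc n)
    have y: "3 * x - real (\<epsilon> 0) \<in> cantor_stage n"
      by (rule Suc.IH[OF cantor_expansion_shift[OF Suc.prems]])
    have "\<epsilon> 0 = 0 \<or> \<epsilon> 0 = 2"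
      using Suc.prems by (auto simp: cantor_expansion_def)
    thus ?case
    proof
      assume "\<epsilon> 0 = 0"
      hence "x \<in> (\<lambda>x. x / 3) ` cantor_stage n"
        using y by (intro image_eqI[of x _ "3 * x"]) auto
      thus ?thesis by simp
    next
      assume "\<epsilon> 0 = 2"
      hence "x \<in> (\<lambda>x. (2 + x) / 3) ` cantor_stage n"
        using y by (intro image_eqI[of x _ "3 * x - 2"]) auto
      thus ?thesis by simp
    qed
  qed
  thus ?thesis by (simp add: cantor_set_def)
qed

lemma cantor_stage_subset: "cantor_stage n \<subseteq> {0..1}"
proof (induction n)
  case (Suc n)
  show ?case
  proof
    fix x assume "x \<in> cantor_stage (Suc n)"
    then obtain y where "y \<in> cantor_stage n" "x = y / 3 \<or> x = (2 + y) / 3" by auto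
    thus "x \<in> {0..1}" using Suc.IH by fastforce
  qed
qed simp

lemma cantor_expansion_exists:
  assumes "x \<in> cantor_set"
  shows "\<exists>\<epsilon>. cantor_expansion x \<epsilon>"
proof -
  define d :: "real \<Rightarrow> nat" where "d x = (if x \<le> 1/2 then 0 else 2)" for x
  define T where "T x = 3 * x - real (d x)" for x :: real
  have T: "T x \<in> cantor_set" if "x \<in> cantor_set" for x
  proof -
    have "T x \<in> cantor_stage n" for n
    proof -
      have "x \<in> cantor_stage (Suc n)" using that unfolding cantor_set_def by (rule INT_D) simp
      then obtain y where y: "y \<in> cantor_stage n" "x = y / 3 \<or> x = (2 + y) / 3" by auto
      have "0 \<le> y" "y \<le> 1" using y(1) cantor_stage_subset[of n] by auto
      hence "T x = y" using y(2) by (auto simp: T_def d_def)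
      thus ?thesis using y(1) by simp
    qed
    thus ?thesis by (simp add: cantor_set_def)
  qed
  have Tn: "(T ^^ n) x \<in> cantor_set" for n
    by (induction n) (auto intro: assms T)
  have partial: "(\<Sum>i<n. real (d ((T ^^ i) x)) / 3 ^ Suc i) = x - (T ^^ n) x / 3 ^ n" for n
    by (induction n) (auto simp: T_def field_simps)
  have "(\<lambda>n. (T ^^ n) x / 3 ^ n) \<longlonglongrightarrow> 0"
  proof (rule tendsto_sandwich[OF _ _ tendsto_const])
    have b: "0 \<le> (T ^^ n) x \<and> (T ^^ n) x \<le> 1" for n
    proof -
      have "(T ^^ n) x \<in> cantor_stage 0"
        using Tn[of n] unfolding cantor_set_def by (rule INT_D) simp
      thus ?thesis by simp
    qed
    show "\<forall>\<^sub>F n in sequentially. 0 \<le> (T ^^ n) x / 3 ^ n"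
      using b by simp
    show "\<forall>\<^sub>F n in sequentially. (T ^^ n) x / 3 ^ n \<le> (1/3) ^ n"
      using b by (auto simp: power_one_over divide_right_mono)
    show "(\<lambda>n. (1/3::real) ^ n) \<longlonglongrightarrow> 0"
      by (rule LIMSEQ_power_zero) simp
  qed
  hence "(\<lambda>n. x - (T ^^ n) x / 3 ^ n) \<longlonglongrightarrow> x - 0"
    by (intro tendsto_diff tendsto_const)
  hence "(\<lambda>i. real (d ((T ^^ i) x)) / 3 ^ Suc i) sums x"
    unfolding sums_def partial by simp
  hence "cantor_expansion x (\<lambda>i. d ((T ^^ i) x))"
    by (auto simp: cantor_expansion_def d_def)
  thus ?thesis by blast
qed

lemma cantor_set_iff_expansion: "x \<in> cantor_set \<longleftrightarrow> (\<exists>!\<epsilon>. cantor_expansion x \<epsilon>)"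
  using cantor_expansion_exists[of x] cantor_expansion_unique[of x]
    cantor_expansion_in_cantor_set[of x] by blast

lemma cantor_digits_eqI: "cantor_expansion x \<epsilon> \<Longrightarrow> cantor_digits x = \<epsilon>"
  unfolding cantor_digits_def using cantor_expansion_unique by blast

definition cantor_cylinder :: "nat \<Rightarrow> (nat \<Rightarrow> nat) \<Rightarrow> real set" where
  "cantor_cylinder n b = {x \<in> cantor_set. \<forall>i<n. cantor_digits x i = b i}"

text \<open>
  The properties below determine \<open>\<mu>\<close> uniquely, since the cylinders form a \<open>\<pi>\<close>-system generating the
  Borel sets of \<open>cantor_set\<close>; existence is \<open>is_cantor_measure_exists\<close>.
\<close>

definition is_cantor_measure :: "real measure \<Rightarrow> bool" where
  "is_cantor_measure \<mu> \<longleftrightarrow>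
     prob_space \<mu> \<and> space \<mu> = cantor_set \<and> sets \<mu> = sets (restrict_space borel cantor_set) \<and>
     (\<forall>n b. (\<forall>i<n. b i \<in> {0, 2}) \<longrightarrow> measure \<mu> (cantor_cylinder n b) = 1 / 2 ^ n)"

lemma compact_cantor_set: "compact cantor_set"
proof -
  have "compact (cantor_stage n)" for n
    by (induction n) (auto intro!: compact_Un compact_continuous_image continuous_intros)
  thus ?thesis
    unfolding cantor_set_def by (intro compact_Inter) auto
qed

lemma cantor_expansion_Cons:
  assumes "cantor_expansion y \<delta>" "e \<in> {0, 2}"
  shows "cantor_expansion ((real e + y) / 3) (case_nat e \<delta>)"
proof -
  have "(\<lambda>i. real (\<delta> i) / 3 ^ Suc i) sums y"
    using assms by (simp add: cantor_expansion_def)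
  hence "(\<lambda>i. real (\<delta> i) / 3 ^ Suc i / 3) sums (y / 3)"
    by (rule sums_divide)
  hence "(\<lambda>i. real (case_nat e \<delta> (Suc i)) / 3 ^ Suc (Suc i)) sums (y / 3)"
    by (simp add: field_simps)
  hence "(\<lambda>i. real (case_nat e \<delta> i) / 3 ^ Suc i) sums (y / 3 + real (case_nat e \<delta> 0) / 3 ^ Suc 0)"
    by (subst (asm) sums_Suc_iff) simp
  thus ?thesis
    using assms by (auto simp: cantor_expansion_def add_divide_distrib add.commute split: nat.split)
qed

lemma cantor_expansion_digits: "x \<in> cantor_set \<Longrightarrow> cantor_expansion x (cantor_digits x)"
  using cantor_expansion_exists cantor_digits_eqI by blast

lemma cantor_cylinder_Suc:
  assumes "b 0 \<in> {0, 2}"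
  shows "cantor_cylinder (Suc n) b =
    (\<lambda>y. (real (b 0) + y) / 3) ` cantor_cylinder n (\<lambda>i. b (Suc i))"
proof (intro equalityI subsetI)
  fix x assume x: "x \<in> cantor_cylinder (Suc n) b"
  define y where "y = 3 * x - real (b 0)"
  have e: "cantor_expansion x (cantor_digits x)" and d: "\<And>i. i < Suc n \<Longrightarrow> cantor_digits x i = b i"
    using x cantor_expansion_digits by (auto simp: cantor_cylinder_def)
  have y: "cantor_expansion y (\<lambda>i. cantor_digits x (Suc i))"
    using cantor_expansion_shift[OF e] d[of 0] by (simp add: y_def)
  have "y \<in> cantor_cylinder n (\<lambda>i. b (Suc i))"
    using cantor_expansion_in_cantor_set[OF y] cantor_digits_eqI[OF y] d
    by (auto simp: cantor_cylinder_def)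
  moreover have "x = (real (b 0) + y) / 3" by (simp add: y_def)
  ultimately show "x \<in> (\<lambda>y. (real (b 0) + y) / 3) ` cantor_cylinder n (\<lambda>i. b (Suc i))"
    by blast
next
  fix x assume "x \<in> (\<lambda>y. (real (b 0) + y) / 3) ` cantor_cylinder n (\<lambda>i. b (Suc i))"
  then obtain y where y: "y \<in> cantor_cylinder n (\<lambda>i. b (Suc i))" "x = (real (b 0) + y) / 3"
    by blast
  have x: "cantor_expansion x (case_nat (b 0) (cantor_digits y))"
    unfolding y(2) using y(1) assms
    by (intro cantor_expansion_Cons cantor_expansion_digits) (auto simp: cantor_cylinder_def)
  show "x \<in> cantor_cylinder (Suc n) b"
    using cantor_expansion_in_cantor_set[OF x] cantor_digits_eqI[OF x] y(1)
    by (auto simp: cantor_cylinder_def split: nat.split)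
qed

lemma compact_cantor_cylinder:
  assumes "\<forall>i<n. b i \<in> {0, 2}"
  shows "compact (cantor_cylinder n b)"
  using assms
proof (induction n arbitrary: b)
  case 0
  thus ?case using compact_cantor_set by (simp add: cantor_cylinder_def)
next
  case (Suc n)
  have "compact (cantor_cylinder n (\<lambda>i. b (Suc i)))"
    using Suc.prems by (intro Suc.IH) auto
  thus ?case
    using Suc.prems
    by (subst cantor_cylinder_Suc) (auto intro!: compact_continuous_image continuous_intros)
qed

lemma is_cantor_measure_exists: "\<exists>\<mu>. is_cantor_measure \<mu>"
proof -
  define B where "B = measure_pmf (bernoulli_pmf (1/2))"
  define P where "P = PiM UNIV (\<lambda>_::nat. B)"
  define e :: "bool \<Rightarrow> nat" where "e c = (if c then 2 else 0)" for c
  define h :: "(nat \<Rightarrow> bool) \<Rightarrow> real" where "h \<omega> = (\<Sum>i. real (e (\<omega> i)) / 3 ^ Suc i)" for \<omega>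
  define \<mu> where "\<mu> = distr P (restrict_space borel cantor_set) h"
  interpret B: prob_space B unfolding B_def by unfold_locales
  interpret prod: product_prob_space "\<lambda>_::nat. B" UNIV by unfold_locales
  interpret P: prob_space P unfolding P_def by (rule prob_space_PiM) unfold_locales
  have space_P: "space P = UNIV" by (simp add: P_def B_def space_PiM)
  have h: "cantor_expansion (h \<omega>) (\<lambda>i. e (\<omega> i))" for \<omega>
  proof -
    have "summable (\<lambda>i. (2/3) * (1/3::real) ^ i)"
      by (intro summable_mult summable_geometric) simp
    hence "summable (\<lambda>i. real (e (\<omega> i)) / 3 ^ Suc i)"
      by (rule summable_comparison_test'[where N=0])
        (auto simp: e_def power_one_over field_simps)
    thus ?thesis
      by (auto simp: cantor_expansion_def e_def h_def summable_sums)
  qed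
  have "h \<in> borel_measurable P"
    unfolding h_def
  proof (rule borel_measurable_suminf)
    fix i
    have "(\<lambda>\<omega>. \<omega> i) \<in> measurable P B" unfolding P_def by measurable
    moreover have "(\<lambda>c. real (e c) / 3 ^ Suc i) \<in> borel_measurable B" by (simp add: B_def)
    ultimately show "(\<lambda>\<omega>. real (e (\<omega> i)) / 3 ^ Suc i) \<in> borel_measurable P"
      by (rule measurable_compose)
  qed
  hence h_meas: "h \<in> measurable P (restrict_space borel cantor_set)"
    using cantor_expansion_in_cantor_set[OF h] by (intro measurable_restrict_space2) auto
  have "measure \<mu> (cantor_cylinder n b) = 1 / 2 ^ n" if b: "\<forall>i<n. b i \<in> {0, 2}" for n b
  proof -
    have "cantor_cylinder n b \<in> sets (restrict_space borel cantor_set)"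
      using compact_cantor_cylinder[OF b] compact_cantor_set
      by (subst sets_restrict_space_iff)
        (auto simp: cantor_cylinder_def borel_compact)
    hence "measure \<mu> (cantor_cylinder n b) = measure P (h -` cantor_cylinder n b \<inter> space P)"
      unfolding \<mu>_def using h_meas by (rule measure_distr[rotated])
    also have "h -` cantor_cylinder n b \<inter> space P =
        prod_emb UNIV (\<lambda>_. B) {..<n} (\<Pi>\<^sub>E i\<in>{..<n}. {b i = 2})"
    proof -
      have "e c = k \<longleftrightarrow> c = (k = 2)" if "k = 0 \<or> k = 2" for c k
        using that by (auto simp: e_def)
      hence "(\<forall>i<n. e (\<omega> i) = b i) \<longleftrightarrow> (\<forall>i<n. \<omega> i = (b i = 2))" for \<omega>
        using b by auto
      thus ?thesis
        using cantor_expansion_in_cantor_set[OF h] cantor_digits_eqI[OF h]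
        by (auto simp: space_P cantor_cylinder_def prod_emb_def B_def PiE_iff)
    qed
    also have "measure P \<dots> = (\<Prod>i<n. measure B {b i = 2})"
      unfolding P_def by (rule prod.measure_PiM_emb) (auto simp: B_def)
    also have "\<dots> = 1 / 2 ^ n"
      by (simp add: B_def measure_pmf_single pmf_bernoulli_half power_one_over)
    finally show ?thesis .
  qed
  moreover have "prob_space \<mu>"
    unfolding \<mu>_def by (rule P.prob_space_distr[OF h_meas])
  ultimately have "is_cantor_measure \<mu>"
    by (simp add: is_cantor_measure_def \<mu>_def space_restrict_space)
  thus ?thesis ..
qed

definition purely_periodic :: "nat \<Rightarrow> (nat \<Rightarrow> 'a) \<Rightarrow> bool" where
  "purely_periodic m s \<longleftrightarrow> m \<ge> 1 \<and> (\<forall>i. s (i + m) = s i)"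

definition prelength :: "(nat \<Rightarrow> 'a) \<Rightarrow> nat" where
  "prelength s = (LEAST l. \<exists>m. purely_periodic m (\<lambda>i. s (l + i)))"

definition period :: "(nat \<Rightarrow> 'a) \<Rightarrow> nat" where
  "period s = (LEAST m. purely_periodic m (\<lambda>i. s (prelength s + i)))"

lemma cantor_digits_ultimately_periodic:
  assumes "r \<in> cantor_set" "r \<in> \<rat>"
  shows "\<exists>l m. purely_periodic m (\<lambda>i. cantor_digits r (l + i))"
proof -
  let ?\<epsilon> = "cantor_digits r"
  obtain p q :: int where q: "q > 0" "r = of_int p / of_int q"
    using assms(2) by (auto elim!: Rats_cases')
  have "\<exists>c::int. cantor_expansion (3 ^ n * r - of_int c) (\<lambda>i. ?\<epsilon> (n + i))" for n
  proof (induction n)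
    case 0
    show ?case using cantor_expansion_digits[OF assms(1)] by (intro exI[of _ 0]) simp
  next
    case (Suc n)
    then obtain c :: int where "cantor_expansion (3 ^ n * r - of_int c) (\<lambda>i. ?\<epsilon> (n + i))" by blast
    from cantor_expansion_shift[OF this] show ?case
      by (intro exI[of _ "3 * c + int (?\<epsilon> n)"]) (simp add: algebra_simps)
  qed
  then obtain c :: "nat \<Rightarrow> int"
    where c: "\<And>n. cantor_expansion (3 ^ n * r - of_int (c n)) (\<lambda>i. ?\<epsilon> (n + i))"
    by metis
  define k where "k n = 3 ^ n * p - q * c n" for n
  have t: "3 ^ n * r - of_int (c n) = of_int (k n) / of_int q" for n
    using q by (simp add: k_def field_simps)
  have "k n \<in> {0..q}" for n
    using cantor_expansion_bounds[OF c[of n]] q(1) unfolding t by (auto simp: field_simps)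
  hence "finite (range k)" by (meson finite_atLeastAtMost_int finite_subset image_subsetI)
  hence "\<not> inj k" using finite_imageD by blast
  then obtain a b where ab: "a < b" "k a = k b"
    by (metis injI linorder_neqE_nat)
  have eq: "(\<lambda>i. ?\<epsilon> (a + i)) = (\<lambda>i. ?\<epsilon> (b + i))"
    using c[of a] c[of b] unfolding t ab(2) by (rule cantor_expansion_unique)
  have "?\<epsilon> (a + (i + (b - a))) = ?\<epsilon> (a + i)" for i
  proof -
    have "a + (i + (b - a)) = b + i" using ab(1) by simp
    thus ?thesis using fun_cong[OF eq, of i] by metis
  qed
  hence "purely_periodic (b - a) (\<lambda>i. ?\<epsilon> (a + i))"
    using ab(1) by (simp add: purely_periodic_def)
  thus ?thesis by blast
qed

text \<open>
  Only meaningful for rational points of \<open>cantor_set\<close>, where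
  \<open>cantor_digits_ultimately_periodic\<close> makes both \<open>LEAST\<close>s well defined.
\<close>

definition q_int :: "real \<Rightarrow> nat" where
  "q_int r = 3 ^ prelength (cantor_digits r) * (3 ^ period (cantor_digits r) - 1)"

definition W_int :: "(real \<Rightarrow> real) \<Rightarrow> real set" where
  "W_int \<psi> = {x \<in> cantor_set. infinite {r \<in> \<rat> \<inter> cantor_set. \<bar>x - r\<bar> < \<psi> (real (q_int r))}}"

lemma W_int_measurable: "W_int \<psi> \<in> sets (restrict_space borel cantor_set)"
proof -
  define S where "S = \<rat> \<inter> cantor_set"
  define A where "A r = {x \<in> cantor_set. \<bar>x - r\<bar> < \<psi> (real (q_int r))}" for r
  have S: "countable S" by (simp add: S_def countable_Int1 countable_rat)
  have K: "cantor_set \<in> sets borel"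
    using compact_cantor_set by (rule borel_compact)
  have "A r = cantor_set \<inter> ball r (\<psi> (real (q_int r)))" for r
    by (auto simp: A_def dist_real_def)
  hence A: "A r \<in> sets borel" for r
    using K by simp
  have inf_iff: "infinite {r \<in> S. P r} \<longleftrightarrow> (\<forall>F\<in>{F. finite F \<and> F \<subseteq> S}. \<exists>r\<in>S - F. P r)" for P
  proof
    assume inf: "infinite {r \<in> S. P r}"
    show "\<forall>F\<in>{F. finite F \<and> F \<subseteq> S}. \<exists>r\<in>S - F. P r"
    proof (safe, rule ccontr)
      fix F assume "finite F" "\<not> (\<exists>r\<in>S - F. P r)"
      hence "{r \<in> S. P r} \<subseteq> F" by blast
      thus False using inf \<open>finite F\<close> finite_subset by blast
    qed
  next
    assume all: "\<forall>F\<in>{F. finite F \<and> F \<subseteq> S}. \<exists>r\<in>S - F. P r"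
    show "infinite {r \<in> S. P r}"
    proof
      assume "finite {r \<in> S. P r}"
      hence "{r \<in> S. P r} \<in> {F. finite F \<and> F \<subseteq> S}" by auto
      from bspec[OF all this] have "\<exists>r\<in>S - {r \<in> S. P r}. P r" .
      thus False by blast
    qed
  qed
  have "W_int \<psi> = cantor_set \<inter> (\<Inter>F\<in>{F. finite F \<and> F \<subseteq> S}. \<Union>r\<in>S - F. A r)"
  proof (rule set_eqI)
    fix x
    have "x \<in> W_int \<psi> \<longleftrightarrow> x \<in> cantor_set \<and> infinite {r \<in> S. x \<in> A r}"
      by (auto simp: W_int_def S_def A_def)
    thus "x \<in> W_int \<psi> \<longleftrightarrow>
        x \<in> cantor_set \<inter> (\<Inter>F\<in>{F. finite F \<and> F \<subseteq> S}. \<Union>r\<in>S - F. A r)"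
      by (simp only: inf_iff Int_iff INT_iff UN_iff)
  qed
  also have "\<dots> \<in> sets borel"
  proof (intro sets.Int K sets.countable_INT'' sets.countable_UN')
    show "countable {F. finite F \<and> F \<subseteq> S}"
      using S by (rule countable_Collect_finite_subset)
  qed (use A S in auto)
  finally show ?thesis
    using K by (subst sets_restrict_space_iff) (auto simp: W_int_def)
qed

text \<open>
  \<open>\<real>\<^sup>+\<close> is read as \<open>{0<..}\<close>; values of \<open>f\<close> outside this set are irrelevant.
\<close>

definition dimension_function :: "(real \<Rightarrow> real) \<Rightarrow> bool" where
  "dimension_function f \<longleftrightarrow>
     (\<forall>r>0. f r > 0) \<and> continuous_on {0<..} f \<and> mono_on {0<..} f \<and> (f \<longlongrightarrow> 0) (at_right 0)"

text \<open>
  Countable covers are sequences, padded with empty sets if necessary. Sets of diameter \<open>0\<close> have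
  weight \<open>0\<close>, that is, \<open>f\<close> is extended continuously by \<open>f(0) = 0\<close>. Boundedness is required
  explicitly because \<^const>\<open>diameter\<close> is not meaningful on unbounded sets.
\<close>

definition hausdorff_premeasure :: "(real \<Rightarrow> real) \<Rightarrow> real \<Rightarrow> 'a::metric_space set \<Rightarrow> ennreal" where
  "hausdorff_premeasure f \<delta> A =
     (INF U \<in> {U :: nat \<Rightarrow> 'a set. A \<subseteq> (\<Union>i. U i) \<and> (\<forall>i. bounded (U i) \<and> diameter (U i) \<le> \<delta>)}.
        \<Sum>i. if diameter (U i) = 0 then 0 else ennreal (f (diameter (U i))))"

definition hausdorff_measure :: "(real \<Rightarrow> real) \<Rightarrow> 'a::metric_space set \<Rightarrow> ennreal" where
  "hausdorff_measure f A = (SUP \<delta> \<in> {0<..}. hausdorff_premeasure f \<delta> A)"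

end

(*
  By monotonicity, psi(3^n) may replace psi(q_int) up to a shift of n, where n is prelength plus
  period, and there are at most n 2^n rationals with given n. As the ball of radius rho around a
  point of the Cantor set has measure at most 2 rho^gamma, the convergence case is Borel-Cantelli.

  For divergence let k_n be least with 3^-(n + k_n) < psi(3^n). If the digits of x at the k_n
  places from n on repeat those from some l < n on, then x is close enough to the rational with
  prelength at most l whose digits repeat with period n - l. Such a repetition has probability
  2^-k_n, and, for l and k_n at most n/4, any two of them are independent unless they have
  overlapping ranges and the same difference n - l. So the variance of the number of repetitions
  is at most four times its mean, and Chebyshev's inequality shows that there are infinitely many
  almost surely.

  Since f(r)/r^gamma is non-decreasing, covers by disjoint cylinders give
  H^f(E) <= f(r)/r^gamma * mu(E) for every r > 0 and every measurable E. Hence null sets of mu are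
  null for H^f, and if the infimum of f(r)/r^gamma is 0, so is H^f(K); otherwise the series with f
  and the one for mu converge simultaneously. This gives the result on Hausdorff measures.
*)

theory Submission
  imports Defs
begin

section \<open>Digits and rational points\<close>

lemma cantor_digit_cases:
  assumes "x \<in> cantor_set"
  shows "cantor_digits x i \<in> {0, 2}"
  using cantor_expansion_digits[OF assms] by (simp add: cantor_expansion_def)

lemma cantor_expansion_of_digits:
  assumes "\<And>i. \<epsilon> i \<in> {0, 2}"
  shows "\<exists>x. cantor_expansion x \<epsilon>"
proof -
  have "summable (\<lambda>i. (2/3) * (1/3::real) ^ i)"
    by (intro summable_mult summable_geometric) simp
  hence "summable (\<lambda>i. real (\<epsilon> i) / 3 ^ Suc i)"
  proof (rule summable_comparison_test'[where N=0])
    fix i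
    show "norm (real (\<epsilon> i) / 3 ^ Suc i) \<le> (2/3) * (1/3::real) ^ i"
      using assms[of i] by (auto simp: power_one_over field_simps)
  qed
  thus ?thesis
    using assms by (auto simp: cantor_expansion_def summable_sums)
qed

lemma cantor_expansion_drop:
  assumes "cantor_expansion x \<epsilon>"
  shows "cantor_expansion (3 ^ n * (x - (\<Sum>i<n. real (\<epsilon> i) / 3 ^ Suc i))) (\<lambda>i. \<epsilon> (n + i))"
proof (induction n)
  case 0
  show ?case using assms by simp
next
  case (Suc n)
  from cantor_expansion_shift[OF this] show ?case
    by (simp add: algebra_simps)
qed

text \<open>Once the \<open>n\<close> common digits are removed and the rest is scaled by
  \<open>3 ^ n\<close>, both remainders are again points of the unit interval.\<close>

lemma cantor_expansion_agree:
  assumes "cantor_expansion x \<epsilon>" "cantor_expansion y \<delta>" "\<And>i. i < n \<Longrightarrow> \<epsilon> i = \<delta> i"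
  shows "\<bar>x - y\<bar> \<le> 1 / 3 ^ n"
proof -
  let ?S = "\<Sum>i<n. real (\<epsilon> i) / 3 ^ Suc i"
  have S: "(\<Sum>i<n. real (\<delta> i) / 3 ^ Suc i) = ?S"
    using assms(3) by (intro sum.cong) auto
  note bx = cantor_expansion_bounds[OF cantor_expansion_drop[OF assms(1), of n]]
  note by' = cantor_expansion_bounds[OF cantor_expansion_drop[OF assms(2), of n], unfolded S]
  have "\<bar>3 ^ n * (x - ?S) - 3 ^ n * (y - ?S)\<bar> \<le> 1"
    using bx by' by linarith
  moreover have "3 ^ n * (x - ?S) - 3 ^ n * (y - ?S) = 3 ^ n * (x - y)"
    by (simp add: algebra_simps)
  ultimately have "3 ^ n * \<bar>x - y\<bar> \<le> 1"
    by (simp add: abs_mult)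
  thus ?thesis
    by (simp add: field_simps)
qed

text \<open>A converse to \<open>cantor_expansion_agree\<close>, due to the gaps of the Cantor set:
  at the first differing digit the rescaled points lie in [0, 1/3] and [2/3, 1], so they are at
  least 1/3 apart.\<close>

lemma cantor_expansion_separated:
  assumes "cantor_expansion x \<epsilon>" "cantor_expansion y \<delta>" "\<bar>x - y\<bar> < 1 / 3 ^ n" "i < n"
  shows "\<epsilon> i = \<delta> i"
  using \<open>i < n\<close>
proof (induction i rule: less_induct)
  case (less i)
  let ?S = "\<Sum>j<i. real (\<epsilon> j) / 3 ^ Suc j"
  have S: "(\<Sum>j<i. real (\<delta> j) / 3 ^ Suc j) = ?S"
    using less by (intro sum.cong) auto
  define u v where "u = 3 ^ i * (x - ?S)" and "v = 3 ^ i * (y - ?S)"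
  have u: "cantor_expansion u (\<lambda>j. \<epsilon> (i + j))" and v: "cantor_expansion v (\<lambda>j. \<delta> (i + j))"
    using cantor_expansion_drop[OF assms(1), of i] cantor_expansion_drop[OF assms(2), of i]
    unfolding u_def v_def S by blast+
  have "3 * \<bar>u - v\<bar> = 3 ^ Suc i * \<bar>x - y\<bar>"
    unfolding u_def v_def right_diff_distrib[symmetric] by (simp add: abs_mult)
  also have "\<dots> < 3 ^ Suc i * (1 / 3 ^ n)"
    using assms(3) by (intro mult_strict_left_mono) auto
  also have "\<dots> \<le> 1"
    using less.prems by (simp add: power_increasing_iff[of "3::real" "Suc i" n, simplified])
  finally have "3 * \<bar>u - v\<bar> < 1" .
  moreover have "\<epsilon> i \<in> {0, 2}" "\<delta> i \<in> {0, 2}"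
    using assms by (auto simp: cantor_expansion_def)
  ultimately show ?case
    using cantor_expansion_bounds[OF cantor_expansion_shift[OF u]]
      cantor_expansion_bounds[OF cantor_expansion_shift[OF v]] by auto
qed

section \<open>Ultimately periodic sequences and intrinsic denominators\<close>

lemma purely_periodic_iterate:
  assumes "purely_periodic m s"
  shows "s (i + t * m) = s i"
proof (induction t)
  case (Suc t)
  have "s (i + Suc t * m) = s ((i + t * m) + m)" by (simp add: algebra_simps)
  thus ?case using assms Suc by (simp add: purely_periodic_def)
qed simp

text \<open>Multiples of \<open>m'\<close> move any position beyond \<open>l\<close>, where the period \<open>m\<close> applies.\<close>

lemma purely_periodic_earlier:
  assumes "purely_periodic m (\<lambda>i. s (l + i))" "purely_periodic m' (\<lambda>i. s (p + i))"
  shows "purely_periodic m (\<lambda>i. s (p + i))"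
proof -
  have "s (p + (i + m)) = s (p + i)" for i
  proof -
    have le: "l \<le> l * m'"
      using assms(2) by (cases m') (auto simp: purely_periodic_def)
    define k where "k = p + i + l * m' - l"
    have "s (p + (i + m)) = s (p + ((i + m) + l * m'))"
      using purely_periodic_iterate[OF assms(2), of "i + m" l] by simp
    also have "p + ((i + m) + l * m') = l + (k + m)"
      using le unfolding k_def by linarith
    also have "s \<dots> = s (l + k)"
      using assms(1) by (simp add: purely_periodic_def)
    also have "l + k = p + (i + l * m')"
      using le unfolding k_def by linarith
    also have "s \<dots> = s (p + i)"
      using purely_periodic_iterate[OF assms(2), of i l] by simp
    finally show ?thesis .
  qed
  thus ?thesis
    using assms(1) by (simp add: purely_periodic_def)
qed

text \<open>\<open>period\<close> is a minimum over the tail at the smallest prelength, so a period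
  \<open>m\<close> seen from \<open>l\<close> on has first to be moved to that tail by
  \<open>purely_periodic_earlier\<close>.\<close>

lemma
  assumes "purely_periodic m (\<lambda>i. s (l + i))"
  shows prelength_le: "prelength s \<le> l"
    and period_le: "period s \<le> m"
    and purely_periodic_period: "purely_periodic (period s) (\<lambda>i. s (prelength s + i))"
proof -
  show "prelength s \<le> l"
    unfolding prelength_def using assms by (intro Least_le) blast
  have "\<exists>m. purely_periodic m (\<lambda>i. s (prelength s + i))"
    unfolding prelength_def by (rule LeastI_ex) (use assms in blast)
  then obtain m' where "purely_periodic m' (\<lambda>i. s (prelength s + i))" ..
  from purely_periodic_earlier[OF assms this]
  have m: "purely_periodic m (\<lambda>i. s (prelength s + i))" .
  show "period s \<le> m"
    unfolding period_def using m by (rule Least_le)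
  show "purely_periodic (period s) (\<lambda>i. s (prelength s + i))"
    unfolding period_def using m by (rule LeastI)
qed

text \<open>Since \<open>3 ^ m - 1\<close> lies between \<open>3 ^ (m - 1)\<close> and
  \<open>3 ^ m\<close>, a monotone \<psi> at \<open>q_int r\<close> can be compared with its values
  at powers of 3.\<close>

lemma q_int_bounds:
  assumes "r \<in> cantor_set" "r \<in> \<rat>"
  defines "n \<equiv> prelength (cantor_digits r) + period (cantor_digits r)"
  shows "n \<ge> 1" "3 ^ (n - 1) \<le> q_int r" "q_int r \<le> 3 ^ n"
proof -
  let ?l = "prelength (cantor_digits r)" and ?m = "period (cantor_digits r)"
  obtain l m where "purely_periodic m (\<lambda>i. cantor_digits r (l + i))"
    using cantor_digits_ultimately_periodic assms by blast
  from purely_periodic_period[OF this] have m: "?m \<ge> 1"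
    by (simp add: purely_periodic_def)
  thus "n \<ge> 1" by (simp add: n_def)
  have "(3::nat) ^ (n - 1) = 3 ^ ?l * 3 ^ (?m - 1)"
    using m by (simp add: n_def flip: power_add)
  also have "(3::nat) ^ (?m - 1) \<le> 3 ^ ?m - 1"
    using m by (cases ?m) auto
  finally show "3 ^ (n - 1) \<le> q_int r"
    by (simp add: q_int_def)
  show "q_int r \<le> 3 ^ n"
    by (simp add: q_int_def n_def power_add)
qed

text \<open>Cutting off \<open>l\<close> or \<open>l + m\<close> digits leaves the same tail.
  Equating the two tail values gives a linear equation for \<open>r\<close> with rational
  coefficients.\<close>

lemma rational_if_periodic:
  assumes "cantor_expansion r \<delta>" "purely_periodic m (\<lambda>i. \<delta> (l + i))"
  shows "r \<in> \<rat>"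
proof -
  define S where "S n = (\<Sum>i<n. real (\<delta> i) / 3 ^ Suc i)" for n
  have S: "S n \<in> \<rat>" for n
    unfolding S_def by (intro Rats_sum Rats_divide Rats_power) auto
  have "(\<lambda>i. \<delta> (l + m + i)) = (\<lambda>i. \<delta> (l + i))"
  proof
    fix i
    have "\<delta> (l + (i + m)) = \<delta> (l + i)"
      using assms(2) by (simp add: purely_periodic_def)
    thus "\<delta> (l + m + i) = \<delta> (l + i)" by (simp add: algebra_simps)
  qed
  with cantor_expansion_drop[OF assms(1), of "l + m"]
  have "(\<lambda>i. real (\<delta> (l + i)) / 3 ^ Suc i) sums (3 ^ (l + m) * (r - S (l + m)))"
    by (simp only: cantor_expansion_def S_def)
  moreover have "(\<lambda>i. real (\<delta> (l + i)) / 3 ^ Suc i) sums (3 ^ l * (r - S l))"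
    using cantor_expansion_drop[OF assms(1), of l] by (simp only: cantor_expansion_def S_def)
  ultimately have "3 ^ l * (r - S l) = 3 ^ (l + m) * (r - S (l + m))"
    by (rule sums_unique2[rotated])
  hence "(3 ^ (l + m) - 3 ^ l) * r = 3 ^ (l + m) * S (l + m) - 3 ^ l * S l"
    by (simp add: algebra_simps)
  moreover have "(3::real) ^ (l + m) > 3 ^ l"
    using assms(2) by (intro power_strict_increasing) (auto simp: purely_periodic_def)
  ultimately have "r = (3 ^ (l + m) * S (l + m) - 3 ^ l * S l) / (3 ^ (l + m) - 3 ^ l)"
    by (simp add: field_simps)
  also have "\<dots> \<in> \<rat>"
    using S by (intro Rats_divide Rats_diff Rats_mult Rats_power) auto
  finally show ?thesis .
qed

text \<open>The first \<open>n\<close> digits are continued periodically, repeating the last \<open>n - l\<close> of them.\<close>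

lemma rational_approximation:
  assumes x: "x \<in> cantor_set" and "l < n"
    and rep: "\<forall>j<k. cantor_digits x (n + j) = cantor_digits x (l + j)"
  shows "\<exists>r \<in> \<rat> \<inter> cantor_set. q_int r \<le> 3 ^ n \<and> \<bar>x - r\<bar> \<le> 1 / 3 ^ (n + k)"
proof -
  let ?\<epsilon> = "cantor_digits x"
  define m where "m = n - l"
  have m: "m \<ge> 1" "n = l + m" using \<open>l < n\<close> by (auto simp: m_def)
  define \<delta> where "\<delta> i = (if i < l then ?\<epsilon> i else ?\<epsilon> (l + (i - l) mod m))" for i
  have "\<delta> i \<in> {0, 2}" for i
    using cantor_digit_cases[OF x] unfolding \<delta>_def by presburger
  then obtain r where r: "cantor_expansion r \<delta>"
    using cantor_expansion_of_digits by blast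
  have per: "purely_periodic m (\<lambda>i. \<delta> (l + i))"
    using m by (simp add: purely_periodic_def \<delta>_def)
  \<comment> \<open>From \<open>n\<close> on, both sequences satisfy
    \<open>s (n + j) = s (l + j)\<close>: \<delta> by periodicity, the digits of \<open>x\<close> by
    \<open>rep\<close> as long as \<open>j < k\<close>.\<close>
  have "?\<epsilon> i = \<delta> i" if "i < n + k" for i
    using that
  proof (induction i rule: less_induct)
    case (less i)
    show ?case
    proof (cases "i < n")
      case True
      thus ?thesis using m by (auto simp: \<delta>_def)
    next
      case False
      define j where "j = i - n"
      have i: "i = n + j" and j: "j < k" using False less.prems by (auto simp: j_def)
      have "?\<epsilon> i = ?\<epsilon> (l + j)" using rep j i by simp
      also have "\<dots> = \<delta> (l + j)" using less i m by simp
      also have "\<dots> = \<delta> i"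
        using per by (simp add: i m purely_periodic_def add_ac)
      finally show ?thesis .
    qed
  qed
  hence "\<bar>x - r\<bar> \<le> 1 / 3 ^ (n + k)"
    by (rule cantor_expansion_agree[OF cantor_expansion_digits[OF x] r])
  moreover have rK: "r \<in> \<rat> \<inter> cantor_set"
    using rational_if_periodic[OF r per] cantor_expansion_in_cantor_set[OF r] by blast
  moreover have "q_int r \<le> 3 ^ n"
  proof -
    \<comment> \<open>The true prelength and period of \<open>r\<close> may be smaller than
      \<open>l\<close> and \<open>m\<close>, hence only an upper bound on
      \<open>q_int r\<close>.\<close>
    have "prelength \<delta> + period \<delta> \<le> n"
      using prelength_le[of m \<delta> l, OF per] period_le[of m \<delta> l, OF per] m by simp
    hence "3 ^ (prelength \<delta> + period \<delta>) \<le> (3::nat) ^ n"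
      by (intro power_increasing) auto
    moreover have "q_int r \<le> 3 ^ (prelength \<delta> + period \<delta>)"
      using q_int_bounds(3)[of r] rK unfolding cantor_digits_eqI[OF r] by blast
    ultimately show ?thesis by linarith
  qed
  ultimately show ?thesis by blast
qed

section \<open>Probabilities of repeated blocks\<close>

text \<open>Extensional functions give each cylinder of level \<open>n\<close> exactly one name, so
  that events can be counted on a finite set.\<close>

definition words :: "nat \<Rightarrow> (nat \<Rightarrow> nat) set" where
  "words n = {..<n} \<rightarrow>\<^sub>E {0, 2}"

lemma finite_words [simp]: "finite (words n)"
  by (simp add: words_def finite_PiE)

lemma card_words: "card (words n) = 2 ^ n"
proof -
  have "card {0, 2 :: nat} = 2" by simp
  thus ?thesis by (simp only: words_def card_PiE finite_lessThan prod_constant card_lessThan)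
qed

lemma words_digit: "b \<in> words n \<Longrightarrow> i < n \<Longrightarrow> b i \<in> {0, 2}"
  using PiE_mem[of b "{..<n}" "\<lambda>_. {0, 2}" i] by (simp add: words_def)

lemma restrict_digits_in_words: "x \<in> cantor_set \<Longrightarrow> restrict (cantor_digits x) {..<n} \<in> words n"
  using cantor_digit_cases unfolding words_def by (intro restrict_PiE_iff[THEN iffD2]) auto

lemma in_cylinder_iff:
  assumes "b \<in> words n"
  shows "x \<in> cantor_cylinder n b \<longleftrightarrow> x \<in> cantor_set \<and> restrict (cantor_digits x) {..<n} = b"
proof -
  have "restrict (cantor_digits x) {..<n} = b \<longleftrightarrow> (\<forall>i<n. cantor_digits x i = b i)"
    using assms by (auto simp: words_def PiE_def extensional_def fun_eq_iff)
  thus ?thesis by (auto simp: cantor_cylinder_def)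
qed

definition finitary :: "((nat \<Rightarrow> nat) \<Rightarrow> bool) \<Rightarrow> bool" where
  "finitary Q \<longleftrightarrow> (\<exists>L. \<forall>\<omega> \<omega>'. (\<forall>i<L. \<omega> i = \<omega>' i) \<longrightarrow> Q \<omega> = Q \<omega>')"

text \<open>Not stochastic independence: \<open>Q\<close> never reads digit \<open>u\<close>. For
  finitary \<open>Q\<close> this leaves digit \<open>u\<close> a fair coin given
  \<open>Q\<close>.\<close>

definition indep_of :: "nat \<Rightarrow> ((nat \<Rightarrow> nat) \<Rightarrow> bool) \<Rightarrow> bool" where
  "indep_of u Q \<longleftrightarrow> (\<forall>\<omega> a. Q (fun_upd \<omega> u a) = Q \<omega>)"

lemma finitary_True [simp]: "finitary (\<lambda>\<omega>. True)"
  by (simp add: finitary_def)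

lemma finitary_eq [simp]: "finitary (\<lambda>\<omega>. \<omega> u = \<omega> v)"
  unfolding finitary_def by (intro exI[of _ "Suc (max u v)"]) auto

lemma finitary_conj:
  assumes "finitary P" "finitary Q"
  shows "finitary (\<lambda>\<omega>. P \<omega> \<and> Q \<omega>)"
proof -
  obtain K where K: "\<And>\<omega> \<omega>'. \<forall>i<K. \<omega> i = \<omega>' i \<Longrightarrow> P \<omega> = P \<omega>'"
    using assms(1) unfolding finitary_def by blast
  obtain L where L: "\<And>\<omega> \<omega>'. \<forall>i<L. \<omega> i = \<omega>' i \<Longrightarrow> Q \<omega> = Q \<omega>'"
    using assms(2) unfolding finitary_def by blast
  have "(P \<omega> \<and> Q \<omega>) = (P \<omega>' \<and> Q \<omega>')" if "\<forall>i<max K L. \<omega> i = \<omega>' i" for \<omega> \<omega>'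
    using K[of \<omega> \<omega>'] L[of \<omega> \<omega>'] that by auto
  thus ?thesis unfolding finitary_def by blast
qed

text \<open>For \<open>l < n\<close> this says that the digits from place \<open>l\<close> to place
  \<open>n + k - 1\<close> have period \<open>n - l\<close>. The two blocks overlap if
  \<open>k > n - l\<close>.\<close>

definition matches :: "nat \<Rightarrow> nat \<Rightarrow> nat \<Rightarrow> (nat \<Rightarrow> nat) \<Rightarrow> bool" where
  "matches n l k \<omega> \<longleftrightarrow> (\<forall>j<k. \<omega> (n + j) = \<omega> (l + j))"

lemma matches_0 [simp]: "matches n l 0 \<omega>"
  by (simp add: matches_def)

lemma matches_Suc: "matches n l (Suc k) \<omega> \<longleftrightarrow> matches n l k \<omega> \<and> \<omega> (n + k) = \<omega> (l + k)"
  by (auto simp: matches_def less_Suc_eq)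

lemma finitary_matches [simp]: "finitary (matches n l k)"
  by (induction k) (auto simp: matches_Suc fun_eq_iff[symmetric] intro: finitary_conj)

lemma indep_of_True [simp]: "indep_of u (\<lambda>\<omega>. True)"
  by (simp add: indep_of_def)

lemma indep_of_conj: "indep_of u P \<Longrightarrow> indep_of u Q \<Longrightarrow> indep_of u (\<lambda>\<omega>. P \<omega> \<and> Q \<omega>)"
  by (simp add: indep_of_def)

lemma indep_of_matches:
  assumes "u < n \<or> n + k \<le> u" "u < l \<or> l + k \<le> u"
  shows "indep_of u (matches n l k)"
proof -
  have "n + j \<noteq> u \<and> l + j \<noteq> u" if "j < k" for j using assms that by linarith
  thus ?thesis by (auto simp: indep_of_def matches_def)
qed

section \<open>Digit events under the Cantor measure\<close>

locale cantor_measure = prob_space \<mu> for \<mu> :: "real measure" +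
  assumes is_cantor: "is_cantor_measure \<mu>"
begin

lemma space_eq: "space \<mu> = cantor_set"
  and sets_eq: "sets \<mu> = sets (restrict_space borel cantor_set)"
  using is_cantor by (auto simp: is_cantor_measure_def)

lemma sets_iff: "A \<in> sets \<mu> \<longleftrightarrow> A \<in> sets borel \<and> A \<subseteq> cantor_set"
  using borel_compact[OF compact_cantor_set] unfolding sets_eq
  by (subst sets_restrict_space_iff) auto

lemma measure_cylinder: "\<forall>i<n. b i \<in> {0, 2} \<Longrightarrow> prob (cantor_cylinder n b) = 1 / 2 ^ n"
  using is_cantor by (simp add: is_cantor_measure_def)

lemma cylinder_in_sets: "\<forall>i<n. b i \<in> {0, 2} \<Longrightarrow> cantor_cylinder n b \<in> sets \<mu>"
  using compact_cantor_cylinder[of n b]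
  by (auto simp: sets_iff borel_compact cantor_cylinder_def)

text \<open>The event is the disjoint union of the cylinders of those words of length
  \<open>L\<close> that satisfy \<open>Q\<close>, each of mass \<open>1 / 2 ^ L\<close>.\<close>

lemma
  assumes "\<And>\<omega> \<omega>'. \<forall>i<L. \<omega> i = \<omega>' i \<Longrightarrow> Q \<omega> = Q \<omega>'"
  shows digit_event_in_sets: "{x \<in> cantor_set. Q (cantor_digits x)} \<in> sets \<mu>"
    and prob_digit_event: "prob {x \<in> cantor_set. Q (cantor_digits x)} = card {b \<in> words L. Q b} / 2 ^ L"
proof -
  have Q: "Q (restrict (cantor_digits x) {..<L}) = Q (cantor_digits x)" for x
    by (rule assms) auto
  have eq: "{x \<in> cantor_set. Q (cantor_digits x)} = (\<Union>b\<in>{b \<in> words L. Q b}. cantor_cylinder L b)"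
    using Q restrict_digits_in_words by (auto simp: in_cylinder_iff)
  have cyl: "cantor_cylinder L b \<in> sets \<mu>" "prob (cantor_cylinder L b) = 1 / 2 ^ L"
    if "b \<in> words L" for b
    using cylinder_in_sets measure_cylinder words_digit[OF that] by blast+
  show "{x \<in> cantor_set. Q (cantor_digits x)} \<in> sets \<mu>"
    unfolding eq using cyl by (intro sets.finite_UN) auto
  have "prob {x \<in> cantor_set. Q (cantor_digits x)} = (\<Sum>b\<in>{b \<in> words L. Q b}. prob (cantor_cylinder L b))"
    unfolding eq
  proof (rule finite_measure_finite_Union)
    show "disjoint_family_on (cantor_cylinder L) {b \<in> words L. Q b}"
      by (auto simp: disjoint_family_on_def in_cylinder_iff)
  qed (use cyl in auto)
  also have "\<dots> = (\<Sum>b\<in>{b \<in> words L. Q b}. 1 / 2 ^ L)"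
    by (intro sum.cong) (auto simp: cyl)
  also have "\<dots> = card {b \<in> words L. Q b} / 2 ^ L"
    by simp
  finally show "prob {x \<in> cantor_set. Q (cantor_digits x)} = card {b \<in> words L. Q b} / 2 ^ L" .
qed

definition pr :: "((nat \<Rightarrow> nat) \<Rightarrow> bool) \<Rightarrow> real" where
  "pr Q = prob {x \<in> cantor_set. Q (cantor_digits x)}"

lemma finitary_in_sets:
  assumes "finitary Q"
  shows "{x \<in> cantor_set. Q (cantor_digits x)} \<in> sets \<mu>"
proof -
  obtain L where "\<And>\<omega> \<omega>'. \<forall>i<L. \<omega> i = \<omega>' i \<Longrightarrow> Q \<omega> = Q \<omega>'"
    using assms unfolding finitary_def by blast
  thus ?thesis by (rule digit_event_in_sets)
qed

lemma pr_True: "pr (\<lambda>\<omega>. True) = 1"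
  using prob_space by (simp add: pr_def space_eq)

text \<open>Changing digit \<open>u\<close> toggles the constraint and preserves \<open>Q\<close>.\<close>

lemma pr_conj_eq_digit:
  assumes "finitary Q" "indep_of u Q" "u \<noteq> v"
  shows "pr (\<lambda>\<omega>. Q \<omega> \<and> \<omega> u = \<omega> v) = pr Q / 2"
proof -
  obtain L0 where L0: "\<And>\<omega> \<omega>'. \<forall>i<L0. \<omega> i = \<omega>' i \<Longrightarrow> Q \<omega> = Q \<omega>'"
    using assms(1) unfolding finitary_def by blast
  define L where "L = Suc (L0 + u + v)"
  have L: "Q \<omega> = Q \<omega>'" if "\<forall>i<L. \<omega> i = \<omega>' i" for \<omega> \<omega>'
    using L0[of \<omega> \<omega>'] that by (auto simp: L_def)
  have uv: "u < L" "v < L" by (auto simp: L_def)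
  define A1 where "A1 = {b \<in> words L. Q b \<and> b u = b v}"
  define A2 where "A2 = {b \<in> words L. Q b \<and> b u \<noteq> b v}"
  define flip :: "(nat \<Rightarrow> nat) \<Rightarrow> (nat \<Rightarrow> nat)" where "flip b = fun_upd b u (2 - b u)" for b
  have flip_flip: "flip (flip b) = b" if "b \<in> words L" for b
    using words_digit[OF that uv(1)] by (auto simp: flip_def fun_eq_iff)
  have flip_words: "flip b \<in> words L" if "b \<in> words L" for b
  proof -
    have "2 - b u \<in> {0, 2}" using words_digit[OF that uv(1)] by auto
    hence "flip b \<in> insert u {..<L} \<rightarrow>\<^sub>E {0, 2}"
      using that unfolding words_def flip_def by (intro PiE_fun_upd)
    moreover have "insert u {..<L} = {..<L}" using uv by auto
    ultimately show ?thesis by (simp add: words_def)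
  qed
  have flip_Q: "Q (flip b) = Q b" for b
    using assms(2) by (simp add: indep_of_def flip_def)
  have flip_uv: "flip b u = flip b v \<longleftrightarrow> b u \<noteq> b v" if "b \<in> words L" for b
    using words_digit[OF that uv(1)] words_digit[OF that uv(2)] \<open>u \<noteq> v\<close> by (auto simp: flip_def)
  have "bij_betw flip A1 A2"
    by (rule bij_betw_byWitness[where f' = flip])
      (auto simp: A1_def A2_def flip_flip flip_words flip_Q flip_uv)
  hence "card A1 = card A2" by (rule bij_betw_same_card)
  moreover have "card {b \<in> words L. Q b} = card A1 + card A2"
    unfolding A1_def A2_def
    by (subst card_Un_disjoint[symmetric]) (auto intro: arg_cong[where f = card])
  moreover have "pr Q = card {b \<in> words L. Q b} / 2 ^ L"
    unfolding pr_def using L by (rule prob_digit_event)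
  moreover have "pr (\<lambda>\<omega>. Q \<omega> \<and> \<omega> u = \<omega> v) = card A1 / 2 ^ L"
    unfolding pr_def A1_def
  proof (rule prob_digit_event)
    fix \<omega> \<omega>' :: "nat \<Rightarrow> nat" assume "\<forall>i<L. \<omega> i = \<omega>' i"
    thus "(Q \<omega> \<and> \<omega> u = \<omega> v) = (Q \<omega>' \<and> \<omega>' u = \<omega>' v)"
      using L[of \<omega> \<omega>'] uv by simp
  qed
  ultimately show ?thesis by simp
qed

text \<open>When the constraints are added from left to right, each is the first to read its digit
  \<open>n + k\<close>, even if the two blocks overlap, and so halves the probability.\<close>

lemma pr_conj_matches:
  assumes "finitary Q" "\<And>u. n \<le> u \<Longrightarrow> indep_of u Q" "l < n"
  shows "pr (\<lambda>\<omega>. Q \<omega> \<and> matches n l k \<omega>) = pr Q / 2 ^ k"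
proof (induction k)
  case (Suc k)
  have "pr (\<lambda>\<omega>. (Q \<omega> \<and> matches n l k \<omega>) \<and> \<omega> (n + k) = \<omega> (l + k)) = pr (\<lambda>\<omega>. Q \<omega> \<and> matches n l k \<omega>) / 2"
    using assms by (intro pr_conj_eq_digit finitary_conj indep_of_conj indep_of_matches) auto
  thus ?case
    by (simp add: matches_Suc conj_assoc Suc)
qed simp

lemma pr_matches: "l < n \<Longrightarrow> pr (matches n l k) = 1 / 2 ^ k"
  using pr_conj_matches[of "\<lambda>\<omega>. True" n l k] by (simp add: pr_True)

text \<open>
  The constraints \<open>\<omega> i = \<omega> (i - (n - l))\<close> and \<open>\<omega> i = \<omega> (i - (n' - l'))\<close> form a bipartite graph between
  digits below and above \<open>N\<close>. It is a forest, as its paths move monotonically. So leaves can be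
  removed one at a time: the rightmost constraint of the first kind has a leaf below \<open>N\<close>
  unless there is one of the second kind further right, which then has a leaf above \<open>N\<close>.
\<close>

lemma pr_two_matches_aux:
  assumes "l + k \<le> N" "l' + k' \<le> N" "N \<le> n" "N \<le> n'" "n + l' < n' + l"
  shows "pr (\<lambda>\<omega>. matches n l k \<omega> \<and> matches n' l' k' \<omega>) = 1 / 2 ^ (k + k')"
  using assms
proof (induction "k + k'" arbitrary: k k' rule: less_induct)
  case less
  consider (none) "k = 0" "k' = 0"
    | (first) a where "k = Suc a" "k' = 0 \<or> n' + k' \<le> n + k"
    | (second) a where "k' = Suc a" "k = 0 \<or> n + k < n' + k'"
    by (cases k; cases k') (auto simp: not_le intro: leI)
  thus ?case
  proof cases
    case none
    thus ?thesis by (simp add: pr_True)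
  next
    case first
    have ih: "pr (\<lambda>\<omega>. matches n l a \<omega> \<and> matches n' l' k' \<omega>) = 1 / 2 ^ (a + k')"
      using first less by (intro less.hyps) auto
    have "pr (\<lambda>\<omega>. (matches n l a \<omega> \<and> matches n' l' k' \<omega>) \<and> \<omega> (l + a) = \<omega> (n + a)) =
        pr (\<lambda>\<omega>. matches n l a \<omega> \<and> matches n' l' k' \<omega>) / 2"
    proof (intro pr_conj_eq_digit finitary_conj indep_of_conj finitary_matches)
      show "indep_of (l + a) (matches n l a)"
        using first less.prems by (intro indep_of_matches) auto
      show "indep_of (l + a) (matches n' l' k')"
      proof (cases "k' = 0")
        case False
        thus ?thesis
          using first less.prems by (intro indep_of_matches) auto
      qed (simp add: indep_of_def)
      show "l + a \<noteq> n + a" using first less.prems by auto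
    qed
    moreover have "(\<lambda>\<omega>. matches n l k \<omega> \<and> matches n' l' k' \<omega>) =
        (\<lambda>\<omega>. (matches n l a \<omega> \<and> matches n' l' k' \<omega>) \<and> \<omega> (l + a) = \<omega> (n + a))"
      by (auto simp: first matches_Suc)
    ultimately show ?thesis
      using ih first by simp
  next
    case second
    have ih: "pr (\<lambda>\<omega>. matches n l k \<omega> \<and> matches n' l' a \<omega>) = 1 / 2 ^ (k + a)"
      using second less by (intro less.hyps) auto
    have "pr (\<lambda>\<omega>. (matches n l k \<omega> \<and> matches n' l' a \<omega>) \<and> \<omega> (n' + a) = \<omega> (l' + a)) =
        pr (\<lambda>\<omega>. matches n l k \<omega> \<and> matches n' l' a \<omega>) / 2"
    proof (intro pr_conj_eq_digit finitary_conj indep_of_conj finitary_matches)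
      show "indep_of (n' + a) (matches n' l' a)"
        using second less.prems by (intro indep_of_matches) auto
      show "indep_of (n' + a) (matches n l k)"
      proof (cases "k = 0")
        case False
        thus ?thesis
          using second less.prems by (intro indep_of_matches) auto
      qed (simp add: indep_of_def)
      show "n' + a \<noteq> l' + a" using second less.prems by auto
    qed
    moreover have "(\<lambda>\<omega>. matches n l k \<omega> \<and> matches n' l' k' \<omega>) =
        (\<lambda>\<omega>. (matches n l k \<omega> \<and> matches n' l' a \<omega>) \<and> \<omega> (n' + a) = \<omega> (l' + a))"
      by (auto simp: second matches_Suc)
    ultimately show ?thesis
      using ih second by simp
  qed
qed

lemma pr_two_matches:
  assumes "l + k \<le> N" "l' + k' \<le> N" "N \<le> n" "N \<le> n'" "n + l' \<noteq> n' + l"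
  shows "pr (\<lambda>\<omega>. matches n l k \<omega> \<and> matches n' l' k' \<omega>) = 1 / 2 ^ (k + k')"
proof (cases "n + l' < n' + l")
  case True
  thus ?thesis using assms by (intro pr_two_matches_aux)
next
  case False
  hence "pr (\<lambda>\<omega>. matches n' l' k' \<omega> \<and> matches n l k \<omega>) = 1 / 2 ^ (k' + k)"
    using assms by (intro pr_two_matches_aux) auto
  thus ?thesis by (simp add: conj_commute add.commute)
qed

text \<open>If the later block starts where the earlier one has ended, its digits are fresh. If they
  overlap but the shifts \<open>n - l\<close> and \<open>n' - l'\<close> differ,
  \<open>pr_two_matches\<close> applies. With equal shifts both conditions merge into one repetition
  of length \<open>n' - n + k'\<close>, which gives the extra term.\<close>

lemma pr_two_matches_le:
  assumes "4 * l < n" "4 * k \<le> n" "4 * l' < n'" "4 * k' \<le> n'" "n \<le> n'"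
  shows "pr (\<lambda>\<omega>. matches n l k \<omega> \<and> matches n' l' k' \<omega>) \<le>
    1 / 2 ^ k * (1 / 2 ^ k') + (if n + l' = n' + l then 1 / 2 ^ k' * (1 / 2) ^ (n' - n) else 0)"
proof -
  consider "n + k \<le> n'" | "n' < n + k" "n + l' \<noteq> n' + l" | "n' < n + k" "n + l' = n' + l"
    by linarith
  thus ?thesis
  proof cases
    case 1
    have "pr (\<lambda>\<omega>. matches n l k \<omega> \<and> matches n' l' k' \<omega>) = pr (matches n l k) / 2 ^ k'"
      using 1 assms by (intro pr_conj_matches indep_of_matches) auto
    thus ?thesis using assms by (simp add: pr_matches)
  next
    case 2
    \<comment> \<open>Here \<open>l' + k'\<close> stays below \<open>n\<close>, as it is less than
      \<open>n' / 2\<close>, while \<open>n' < n + k\<close> is less than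
      \<open>5 * n / 4\<close>.\<close>
    have "pr (\<lambda>\<omega>. matches n l k \<omega> \<and> matches n' l' k' \<omega>) = 1 / 2 ^ (k + k')"
      by (rule pr_two_matches[where N = n]) (use 2 assms in linarith)+
    thus ?thesis using 2 by (simp add: power_add)
  next
    case 3
    \<comment> \<open>\<open>n' < n + k\<close> leaves no gap: places beyond the first block belong
      to the second, which is displaced by \<open>n' - n\<close>.\<close>
    have sub: "matches n l (n' - n + k') \<omega>" if \<omega>: "matches n l k \<omega>" "matches n' l' k' \<omega>" for \<omega>
      unfolding matches_def
    proof (intro allI impI)
      fix j assume j: "j < n' - n + k'"
      show "\<omega> (n + j) = \<omega> (l + j)"
      proof (cases "j < k")
        case True
        thus ?thesis using \<omega>(1) by (simp add: matches_def)
      next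
        case False
        define i where "i = j - (n' - n)"
        have "i < k'" "n + j = n' + i" "l + j = l' + i"
          using 3 False j assms(5) by (auto simp: i_def)
        thus ?thesis using \<omega>(2) by (simp add: matches_def)
      qed
    qed
    have "pr (\<lambda>\<omega>. matches n l k \<omega> \<and> matches n' l' k' \<omega>) \<le> pr (matches n l (n' - n + k'))"
      unfolding pr_def using sub by (intro finite_measure_mono finitary_in_sets finitary_matches) auto
    also have "\<dots> = 1 / 2 ^ (n' - n + k')"
      using assms by (intro pr_matches) auto
    also have "\<dots> = 1 / 2 ^ k' * (1 / 2) ^ (n' - n)"
      by (simp only: power_add power_one_over) simp
    finally show ?thesis using 3 by (simp add: add_increasing)
  qed
qed

end

section \<open>Infinitely many repetitions\<close>

text \<open>With \<open>Z N\<close> the number of events from \<open>I N\<close> that occur,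
  \<open>bound\<close> makes the variance of \<open>Z N\<close> at most \<open>C\<close> times its
  mean \<open>S N\<close>. By Chebyshev, \<open>Z N\<close> stays at or below a fixed
  \<open>c\<close> with probability O(1 / \<open>S N\<close>), so the counts are unbounded almost
  surely.\<close>

lemma (in prob_space) second_moment_infinitely_often:
  fixes A :: "'i \<Rightarrow> 'a set" and I :: "nat \<Rightarrow> 'i set" and C :: real
  defines "S \<equiv> \<lambda>N. \<Sum>p\<in>I N. prob (A p)"
  assumes fin: "\<And>N. finite (I N)" and meas: "\<And>N p. p \<in> I N \<Longrightarrow> A p \<in> events"
    and lim: "filterlim S at_top sequentially"
    and bound: "\<And>N. (\<Sum>p\<in>I N. \<Sum>q\<in>I N. prob (A p \<inter> A q)) \<le> (S N)\<^sup>2 + C * S N"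
  shows "AE x in M. infinite {p \<in> (\<Union>N. I N). x \<in> A p}"
proof -
  define Z where "Z N x = (\<Sum>p\<in>I N. indicator (A p) x :: real)" for N x
  have Z_meas [measurable]: "Z N \<in> borel_measurable M" for N
    unfolding Z_def using meas by (intro borel_measurable_sum) auto
  have EZ: "expectation (Z N) = S N" for N
    unfolding Z_def S_def using meas[of _ N]
    by (subst Bochner_Integration.integral_sum)
      (auto intro!: integrable_real_indicator sum.cong simp: less_top[symmetric])
  have Z_sq: "(Z N x)\<^sup>2 = (\<Sum>p\<in>I N. \<Sum>q\<in>I N. indicator (A p \<inter> A q) x)" for N x
    unfolding Z_def power2_eq_square sum_product by (simp add: indicator_inter_arith)
  have Z_sq_int: "integrable M (\<lambda>x. (Z N x)\<^sup>2)" for N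
    unfolding Z_sq using meas[of _ N]
    by (intro Bochner_Integration.integrable_sum integrable_real_indicator)
      (auto simp: less_top[symmetric])
  have Z_int: "integrable M (Z N)" for N
    unfolding Z_def using meas[of _ N]
    by (intro Bochner_Integration.integrable_sum integrable_real_indicator)
      (auto simp: less_top[symmetric])
  have EZ_sq: "expectation (\<lambda>x. (Z N x)\<^sup>2) = (\<Sum>p\<in>I N. \<Sum>q\<in>I N. prob (A p \<inter> A q))" for N
  proof -
    have "expectation (\<lambda>x. (Z N x)\<^sup>2) =
        (\<Sum>p\<in>I N. \<Sum>q\<in>I N. expectation (indicator (A p \<inter> A q)))"
      unfolding Z_sq using meas[of _ N]
      by (subst Bochner_Integration.integral_sum)
        (auto intro!: integrable_real_indicator Bochner_Integration.integral_sum
          Bochner_Integration.integrable_sum sum.cong simp: less_top[symmetric])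
    also have "\<dots> = (\<Sum>p\<in>I N. \<Sum>q\<in>I N. prob (A p \<inter> A q))"
      using meas[of _ N] by (intro sum.cong refl) auto
    finally show ?thesis .
  qed
  have var: "variance (Z N) \<le> C * S N" for N
    using bound[of N] by (subst variance_eq[OF Z_int Z_sq_int]) (simp add: EZ EZ_sq)
  have exceeds: "AE x in M. \<exists>N. Z N x > real c" for c
  proof -
    define B where "B N = {x \<in> space M. Z N x \<le> real c}" for N
    have B [measurable]: "B N \<in> events" for N
      unfolding B_def by measurable
    \<comment> \<open>The event that no count ever exceeds \<open>c\<close> lies in every single
      \<open>B N\<close>, and the probability of \<open>B N\<close> tends to 0.\<close>
    have "prob (\<Inter>N. B N) \<le> 0"
    proof (rule tendsto_lowerbound)
      show "((\<lambda>N. C * S N / (S N - real c)\<^sup>2) \<longlongrightarrow> 0) sequentially"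
      proof (rule filterlim_compose[OF _ lim])
        show "((\<lambda>s. C * s / (s - real c)\<^sup>2) \<longlongrightarrow> 0) at_top"
          by real_asymp
      qed
      have "eventually (\<lambda>N. S N > real c) sequentially"
        using lim by (simp add: filterlim_at_top_dense)
      thus "eventually (\<lambda>N. prob (\<Inter>N. B N) \<le> C * S N / (S N - real c)\<^sup>2) sequentially"
      proof eventually_elim
        case (elim N)
        have "prob (\<Inter>N. B N) \<le> prob (B N)"
          by (intro finite_measure_mono) auto
        also have "\<dots> \<le> prob {x \<in> space M. \<bar>Z N x - expectation (Z N)\<bar> \<ge> S N - real c}"
          using elim by (intro finite_measure_mono) (auto simp: B_def EZ)
        also have "\<dots> \<le> variance (Z N) / (S N - real c)\<^sup>2"
          using elim by (intro Chebyshev_inequality Z_meas Z_sq_int) auto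
        also have "\<dots> \<le> C * S N / (S N - real c)\<^sup>2"
          by (intro divide_right_mono var) auto
        finally show ?case .
      qed
    qed simp
    hence "prob (\<Inter>N. B N) = 0"
      using measure_nonneg[of M "\<Inter>N. B N"] by linarith
    hence "AE x in M. x \<notin> (\<Inter>N. B N)"
      by (intro AE_I[where N = "\<Inter>N. B N"]) (auto simp: emeasure_eq_measure)
    thus ?thesis
      by (rule AE_mp) (intro AE_I2, auto simp: B_def not_le)
  qed
  have "AE x in M. \<forall>c. \<exists>N. Z N x > real c"
    using exceeds by (simp add: AE_all_countable)
  thus ?thesis
  proof eventually_elim
    case (elim x)
    show ?case
    proof
      \<comment> \<open>A finite set of occurring events would bound every count
        \<open>Z N x\<close> by its cardinality.\<close>
      assume fin': "finite {p \<in> (\<Union>N. I N). x \<in> A p}"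
      obtain N where N: "Z N x > card {p \<in> (\<Union>N. I N). x \<in> A p}"
        using elim by blast
      have "Z N x = card {p \<in> I N. x \<in> A p}"
        unfolding Z_def using fin[of N] by (simp add: indicator_def sum.If_cases Int_def)
      also have "\<dots> \<le> card {p \<in> (\<Union>N. I N). x \<in> A p}"
        using fin' by (intro of_nat_mono card_mono) auto
      finally show False using N by simp
    qed
  qed
qed

lemma nonneg_not_summable_at_top:
  fixes f :: "nat \<Rightarrow> real"
  assumes "\<And>n. f n \<ge> 0" "\<not> summable f"
  shows "filterlim (\<lambda>N. \<Sum>n<N. f n) at_top sequentially"
  unfolding filterlim_at_top
proof
  fix Z
  obtain N where N: "Z \<le> (\<Sum>n<N. f n)"
    using assms summableI_nonneg_bounded[of f Z] by (meson linear)
  have "Z \<le> (\<Sum>n<M. f n)" if "M \<ge> N" for M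
    using N sum_mono2[of "{..<M}" "{..<N}" f] assms(1) that by force
  thus "\<forall>\<^sub>F N in sequentially. Z \<le> (\<Sum>n<N. f n)"
    by (auto simp: eventually_sequentially)
qed

lemma (in cantor_measure) infinitely_many_matches:
  fixes k :: "nat \<Rightarrow> nat"
  assumes "\<not> summable (\<lambda>n. real n * (1 / 2) ^ k n)"
  shows "AE x in \<mu>. infinite {(n, l). l < n \<and> matches n l (k n) (cantor_digits x)}"
proof -
  \<comment> \<open>Only \<open>n\<close> with \<open>4 * k n \<le> n\<close>, and only
    \<open>l\<close> below \<open>n / 4\<close>, are kept, as \<open>pr_two_matches_le\<close>
    demands.\<close>
  define J where "J N = {n. n < N \<and> 4 * k n \<le> n}" for N
  define I where "I N = Sigma (J N) (\<lambda>n. {l. 4 * l < n})" for N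
  define A where "A p = (case p of (n, l) \<Rightarrow> {x \<in> cantor_set. matches n l (k n) (cantor_digits x)})" for p
  define P where "P p = (1 / 2 :: real) ^ k (fst p)" for p :: "nat \<times> nat"
  define S where "S N = (\<Sum>p\<in>I N. prob (A p))" for N
  define c where "c n = (if 4 * k n \<le> n then real n * (1 / 2) ^ k n else 0)" for n
  have finJ: "finite (J N)" for N by (simp add: J_def)
  have finL: "finite {l. 4 * l < n}" for n :: nat
    by (rule finite_subset[of _ "{..<n}"]) auto
  have fin: "finite (I N)" for N
    unfolding I_def using finJ finL by blast
  have meas: "A p \<in> events" for p
    unfolding A_def by (auto intro: finitary_in_sets split: prod.split)
  have PA: "prob (A p) = P p" if "p \<in> I N" for p N
    using that pr_matches by (auto simp: A_def P_def I_def pr_def power_one_over)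
  \<comment> \<open>The discarded \<open>n\<close> have \<open>k n > n / 4\<close>, so their terms
    are dominated by a summable series.\<close>
  have c_div: "\<not> summable c"
  proof
    assume "summable c"
    moreover have "summable (\<lambda>n. real n * (1 / 2) powr (real n / 4))"
    proof (rule summable_comparison_test_bigo)
      show "summable (\<lambda>n. norm (inverse (real n ^ 2)))"
        using inverse_power_summable[of 2, where 'a = real] by simp
      show "(\<lambda>n. real n * (1 / 2) powr (real n / 4)) \<in> O(\<lambda>n. inverse (real n ^ 2))"
        by real_asymp
    qed
    ultimately have "summable (\<lambda>n. c n + real n * (1 / 2) powr (real n / 4))"
      by (rule summable_add)
    hence "summable (\<lambda>n. real n * (1 / 2) ^ k n)"
    proof (rule summable_comparison_test'[where N = 0])
      fix n
      have "real n * (1 / 2) ^ k n \<le> real n * (1 / 2) powr (real n / 4)" if "\<not> 4 * k n \<le> n"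
        using that by (subst powr_realpow[symmetric])
          (auto intro!: mult_left_mono powr_mono' simp: field_simps)
      thus "norm (real n * (1 / 2) ^ k n) \<le> c n + real n * (1 / 2) powr (real n / 4)"
        by (auto simp: c_def)
    qed
    with assms show False ..
  qed
  \<comment> \<open>Restricting to \<open>4 * l < n\<close> costs at most a factor 4 in the number
    of \<open>l\<close>.\<close>
  have card_ge: "real n / 4 \<le> real (card {l. 4 * l < n})" for n :: nat
  proof -
    have "{l. 4 * l < n} = {..<(n + 3) div 4}" by auto
    hence "card {l. 4 * l < n} = (n + 3) div 4" by simp
    hence "n \<le> 4 * card {l. 4 * l < n}" by linarith
    thus ?thesis by linarith
  qed
  have S_ge: "(\<Sum>n<N. c n) / 4 \<le> S N" for N
  proof -
    have "S N = (\<Sum>p\<in>I N. P p)"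
      unfolding S_def by (intro sum.cong PA) auto
    also have "\<dots> = (\<Sum>n\<in>J N. \<Sum>l\<in>{l. 4 * l < n}. (1 / 2) ^ k n)"
      unfolding I_def P_def using finJ finL by (subst sum.Sigma) (auto simp: case_prod_beta)
    also have "\<dots> = (\<Sum>n\<in>J N. real (card {l. 4 * l < n}) * (1 / 2) ^ k n)"
      by simp
    also have "\<dots> \<ge> (\<Sum>n\<in>J N. real n / 4 * (1 / 2) ^ k n)"
      by (intro sum_mono mult_right_mono card_ge) auto
    also have "(\<Sum>n\<in>J N. real n / 4 * (1 / 2) ^ k n) = (\<Sum>n\<in>J N. c n) / 4"
      unfolding sum_divide_distrib by (intro sum.cong) (auto simp: J_def c_def)
    also have "(\<Sum>n\<in>J N. c n) = (\<Sum>n<N. c n)"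
      by (rule sum.mono_neutral_left) (auto simp: J_def c_def)
    finally show ?thesis .
  qed
  have lim: "filterlim S at_top sequentially"
  proof (rule filterlim_at_top_mono)
    have "filterlim (\<lambda>N. (\<Sum>n<N. c n) * (1 / 4)) at_top sequentially"
      by (rule filterlim_at_top_mult_tendsto_pos[OF tendsto_const _ nonneg_not_summable_at_top[OF _ c_div]])
        (auto simp: c_def)
    thus "filterlim (\<lambda>N. (\<Sum>n<N. c n) / 4) at_top sequentially" by simp
  qed (use S_ge in auto)
  \<comment> \<open>For \<open>p\<close> not later than \<open>q\<close>, \<open>h p q\<close>
    bounds the excess of the joint probability over independence. It vanishes unless both pairs have
    the same difference \<open>n - l\<close>.\<close>
  define h where "h p q = (if fst p \<le> fst q \<and> fst p + snd q = fst q + snd p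
    then P q * (1 / 2) ^ (fst q - fst p) else 0)" for p q :: "nat \<times> nat"
  have h_nonneg: "h p q \<ge> 0" for p q by (simp add: h_def P_def)
  have pair_le: "prob (A p \<inter> A q) \<le> P p * P q + h p q"
    if "p \<in> I N" "q \<in> I N" "fst p \<le> fst q" for p q N
  proof -
    obtain n l n' l' where pq: "p = (n, l)" "q = (n', l')" by (cases p; cases q)
    have "A p \<inter> A q = {x \<in> cantor_set. matches n l (k n) (cantor_digits x) \<and> matches n' l' (k n') (cantor_digits x)}"
      by (auto simp: A_def pq)
    hence "prob (A p \<inter> A q) = pr (\<lambda>\<omega>. matches n l (k n) \<omega> \<and> matches n' l' (k n') \<omega>)"
      by (simp add: pr_def)
    also have "\<dots> \<le> 1 / 2 ^ k n * (1 / 2 ^ k n') +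
        (if n + l' = n' + l then 1 / 2 ^ k n' * (1 / 2) ^ (n' - n) else 0)"
      using that by (intro pr_two_matches_le) (auto simp: pq I_def J_def)
    also have "\<dots> = P p * P q + h p q"
      using that by (auto simp: pq P_def h_def power_one_over)
    finally show ?thesis .
  qed
  have pair: "prob (A p \<inter> A q) \<le> P p * P q + (h p q + h q p)"
    if "p \<in> I N" "q \<in> I N" for p q N
  proof (cases "fst p \<le> fst q")
    case True
    thus ?thesis using pair_le[OF that] h_nonneg[of q p] by simp
  next
    case False
    thus ?thesis using pair_le[OF that(2,1)] h_nonneg[of p q] by (simp add: Int_commute mult.commute)
  qed
  \<comment> \<open>For fixed \<open>q\<close>, the distance \<open>fst q - fst p\<close> determines
    \<open>p\<close>, whose difference \<open>n - l\<close> is prescribed. So the excess is at most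
    \<open>P q\<close> times a geometric series with sum 2.\<close>
  have h_sum: "(\<Sum>p\<in>I N. h p q) \<le> 2 * P q" for q N
  proof -
    define H where "H = {p \<in> I N. fst p \<le> fst q \<and> fst p + snd q = fst q + snd p}"
    have inj: "inj_on (\<lambda>p. fst q - fst p) H"
      by (rule inj_onI) (auto simp: H_def prod_eq_iff)
    have "(\<Sum>p\<in>I N. h p q) = P q * (\<Sum>p\<in>H. (1 / 2) ^ (fst q - fst p))"
      unfolding h_def H_def using fin by (simp add: sum.If_cases Int_def sum_distrib_left)
    also have "(\<Sum>p\<in>H. (1 / 2) ^ (fst q - fst p)) = (\<Sum>d\<in>(\<lambda>p. fst q - fst p) ` H. (1 / 2 :: real) ^ d)"
      by (subst sum.reindex[OF inj]) simp
    also have "\<dots> \<le> (\<Sum>d. (1 / 2) ^ d)"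
      using fin[of N] by (intro sum_le_suminf summable_geometric finite_imageI) (auto simp: H_def)
    also have "(\<Sum>d. (1 / 2 :: real) ^ d) = 2"
      by (subst suminf_geometric) auto
    finally show ?thesis by (simp add: P_def mult.commute)
  qed
  have "AE x in \<mu>. infinite {p \<in> (\<Union>N. I N). x \<in> A p}"
  \<comment> \<open>The constant 4 is 2 for each of the two orders, \<open>h p q\<close> and
    \<open>h q p\<close>.\<close>
  proof (rule second_moment_infinitely_often[where C = 4])
    show "filterlim (\<lambda>N. \<Sum>p\<in>I N. prob (A p)) at_top sequentially"
      using lim unfolding S_def[abs_def] .
    fix N
    have S: "(\<Sum>p\<in>I N. prob (A p)) = (\<Sum>p\<in>I N. P p)"
      by (intro sum.cong PA) auto
    have "(\<Sum>p\<in>I N. \<Sum>q\<in>I N. prob (A p \<inter> A q)) \<le>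
        (\<Sum>p\<in>I N. \<Sum>q\<in>I N. P p * P q + (h p q + h q p))"
      by (intro sum_mono pair)
    also have "\<dots> = (\<Sum>p\<in>I N. P p)\<^sup>2 + ((\<Sum>q\<in>I N. \<Sum>p\<in>I N. h p q) + (\<Sum>p\<in>I N. \<Sum>q\<in>I N. h q p))"
      by (simp add: sum.distrib power2_eq_square sum_product sum.swap[of "\<lambda>p q. h p q" "I N" "I N"])
    also have "\<dots> \<le> (\<Sum>p\<in>I N. P p)\<^sup>2 + ((\<Sum>q\<in>I N. 2 * P q) + (\<Sum>q\<in>I N. 2 * P q))"
      by (intro add_left_mono add_mono sum_mono h_sum)
    also have "\<dots> = (\<Sum>p\<in>I N. P p)\<^sup>2 + 4 * (\<Sum>p\<in>I N. P p)"
      by (simp add: sum_distrib_left[symmetric])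
    finally show "(\<Sum>p\<in>I N. \<Sum>q\<in>I N. prob (A p \<inter> A q)) \<le>
        (\<Sum>p\<in>I N. prob (A p))\<^sup>2 + 4 * (\<Sum>p\<in>I N. prob (A p))"
      unfolding S .
  qed (use fin meas in auto)
  thus ?thesis
  proof eventually_elim
    case (elim x)
    show ?case
      by (rule infinite_super[OF _ elim]) (auto simp: I_def A_def)
  qed
qed

section \<open>Measure of the approximable points\<close>

lemma powr_log_3_2: "(1 / 3 ^ n) powr log 3 2 = 1 / (2::real) ^ n"
proof -
  have "(3 ^ n) powr log 3 2 = (3 powr real n) powr log 3 (2::real)"
    by (simp add: powr_realpow)
  also have "\<dots> = (3 powr log 3 2) powr real n"
    by (simp only: powr_powr mult.commute)
  also have "\<dots> = 2 ^ n"
    by (simp add: powr_realpow)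
  finally show ?thesis by (simp add: powr_divide)
qed

text \<open>By \<open>q_int_bounds\<close>, these rationals have \<open>q_int\<close> between
  \<open>3 ^ (n - 1)\<close> and \<open>3 ^ n\<close>.\<close>

definition rationals_of_size :: "nat \<Rightarrow> real set" where
  "rationals_of_size n =
    {r \<in> \<rat> \<inter> cantor_set. prelength (cantor_digits r) + period (cantor_digits r) = n}"

text \<open>The prelength \<open>l\<close> and the first \<open>n\<close> digits determine the
  rational: since \<open>l\<close> plus the period is \<open>n\<close>, each later digit is copied
  from \<open>n - l\<close> places before. As the period is positive, \<open>l < n\<close>.\<close>

lemma
  shows finite_rationals_of_size: "finite (rationals_of_size n)"
    and card_rationals_of_size: "card (rationals_of_size n) \<le> n * 2 ^ n"
proof -
  define \<phi> where "\<phi> r = (prelength (cantor_digits r), restrict (cantor_digits r) {..<n})" for r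
  have per: "purely_periodic (n - prelength (cantor_digits r))
      (\<lambda>i. cantor_digits r (prelength (cantor_digits r) + i)) \<and> prelength (cantor_digits r) < n"
    if "r \<in> rationals_of_size n" for r
  proof -
    have r: "r \<in> cantor_set" "r \<in> \<rat>" "n = prelength (cantor_digits r) + period (cantor_digits r)"
      using that by (auto simp: rationals_of_size_def)
    obtain l m where "purely_periodic m (\<lambda>i. cantor_digits r (l + i))"
      using cantor_digits_ultimately_periodic r by blast
    from purely_periodic_period[OF this] show ?thesis
      using r(3) by (simp add: purely_periodic_def)
  qed
  have inj: "inj_on \<phi> (rationals_of_size n)"
  proof (rule inj_onI)
    fix r s assume rs: "r \<in> rationals_of_size n" "s \<in> rationals_of_size n" "\<phi> r = \<phi> s"
    define l where "l = prelength (cantor_digits r)"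
    have l: "l < n" "prelength (cantor_digits s) = l"
      using per[OF rs(1)] rs(3) by (auto simp: \<phi>_def l_def)
    have step: "cantor_digits t (l + (i + (n - l))) = cantor_digits t (l + i)" if "t = r \<or> t = s" for t i
      using per[OF rs(1)] per[OF rs(2)] that l by (auto simp: purely_periodic_def l_def)
    have eq: "cantor_digits r i = cantor_digits s i" for i
    proof (induction i rule: less_induct)
      case (less i)
      show ?case
      proof (cases "i < n")
        case True
        have "restrict (cantor_digits r) {..<n} i = restrict (cantor_digits s) {..<n} i"
          using rs(3) by (simp add: \<phi>_def)
        thus ?thesis using True by simp
      next
        case False
        define j where "j = i - n"
        have ij: "l + (j + (n - l)) = i" "l + j < i" using False l by (auto simp: j_def)
        show ?thesis
          using step[of r j] step[of s j] less[OF ij(2)] unfolding ij(1) by simp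
      qed
    qed
    have "r \<in> cantor_set" "s \<in> cantor_set"
      using rs by (auto simp: rationals_of_size_def)
    with eq show "r = s"
      using cantor_expansion_digits[of r] cantor_expansion_digits[of s]
      by (auto simp: cantor_expansion_def intro: sums_unique2)
  qed
  have sub: "\<phi> ` rationals_of_size n \<subseteq> {..<n} \<times> words n"
    using per restrict_digits_in_words by (auto simp: \<phi>_def rationals_of_size_def)
  show "finite (rationals_of_size n)"
    using inj_on_finite[OF inj sub] by simp
  show "card (rationals_of_size n) \<le> n * 2 ^ n"
    using card_inj_on_le[OF inj sub] by (simp add: card_words)
qed

section \<open>Balls, null sets and the two halves of the zero-one law\<close>

context cantor_measure
begin

lemma ball_in_sets: "{x \<in> cantor_set. \<bar>x - r\<bar> < \<rho>} \<in> sets \<mu>"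
proof -
  have "{x \<in> cantor_set. \<bar>x - r\<bar> < \<rho>} = cantor_set \<inter> ball r \<rho>"
    by (auto simp: dist_real_def)
  thus ?thesis
    using borel_compact[OF compact_cantor_set] by (auto simp: sets_iff)
qed

text \<open>By \<open>cantor_expansion_separated\<close>, all points of the ball share their first
  \<open>n\<close> digits with \<open>r\<close>.\<close>

lemma prob_ball_le_power:
  assumes "r \<in> cantor_set" "\<rho> \<le> 1 / 3 ^ n"
  shows "prob {x \<in> cantor_set. \<bar>x - r\<bar> < \<rho>} \<le> 1 / 2 ^ n"
proof -
  have b: "\<forall>i<n. cantor_digits r i \<in> {0, 2}"
    using cantor_digit_cases[OF assms(1)] by blast
  have "{x \<in> cantor_set. \<bar>x - r\<bar> < \<rho>} \<subseteq> cantor_cylinder n (cantor_digits r)"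
  proof
    fix x assume "x \<in> {x \<in> cantor_set. \<bar>x - r\<bar> < \<rho>}"
    hence x: "x \<in> cantor_set" and d: "\<bar>x - r\<bar> < 1 / 3 ^ n"
      using assms(2) by auto
    from cantor_expansion_separated[OF cantor_expansion_digits[OF x] cantor_expansion_digits[OF assms(1)] d]
    show "x \<in> cantor_cylinder n (cantor_digits r)"
      using x by (simp add: cantor_cylinder_def)
  qed
  hence "prob {x \<in> cantor_set. \<bar>x - r\<bar> < \<rho>} \<le> prob (cantor_cylinder n (cantor_digits r))"
    by (intro finite_measure_mono cylinder_in_sets b)
  thus ?thesis using measure_cylinder[OF b] by simp
qed

lemma prob_ball_le:
  assumes "r \<in> cantor_set" "\<rho> > 0"
  shows "prob {x \<in> cantor_set. \<bar>x - r\<bar> < \<rho>} \<le> 2 * \<rho> powr log 3 2"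
proof (cases "\<rho> < 1")
  case False
  hence "1 \<le> \<rho> powr log 3 2"
    by (intro ge_one_powr_ge_zero) auto
  moreover have "prob {x \<in> cantor_set. \<bar>x - r\<bar> < \<rho>} \<le> 1" by simp
  ultimately show ?thesis by linarith
next
  case True
  obtain n0 where "(1 / 3) ^ n0 < \<rho>"
    using real_arch_pow_inv[of \<rho> "1 / 3"] assms by auto
  moreover have "(1 / 3 :: real) ^ Suc n0 \<le> (1 / 3) ^ n0"
    by (intro power_decreasing) auto
  ultimately have ex: "1 / 3 ^ Suc n0 \<le> \<rho>"
    by (simp only: power_one_over)
  \<comment> \<open>This \<open>n\<close> brackets \<rho> between \<open>1 / 3 ^ Suc n\<close> and
    \<open>1 / 3 ^ n\<close>; passing from one to the other costs the factor 2.\<close>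
  define n where "n = (LEAST n. 1 / 3 ^ Suc n \<le> \<rho>)"
  have n: "1 / 3 ^ Suc n \<le> \<rho>"
    unfolding n_def using ex by (rule LeastI)
  have "\<rho> \<le> 1 / 3 ^ n"
  proof (cases n)
    case (Suc m)
    thus ?thesis using not_less_Least[of m "\<lambda>n. 1 / 3 ^ Suc n \<le> \<rho>"] by (simp add: n_def)
  qed (use True in auto)
  hence "prob {x \<in> cantor_set. \<bar>x - r\<bar> < \<rho>} \<le> 1 / 2 ^ n"
    by (rule prob_ball_le_power[OF assms(1)])
  also have "\<dots> = 2 * (1 / 3 ^ Suc n) powr log 3 2"
    by (subst powr_log_3_2) simp
  also have "\<dots> \<le> 2 * \<rho> powr log 3 2"
    using n by (intro mult_left_mono powr_mono2) auto
  finally show ?thesis .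
qed

text \<open>Serves to discard rational \<open>x\<close>, for which infinitely many repetitions might
  all yield the single approximation \<open>x\<close> itself.\<close>

lemma rationals_null: "\<rat> \<inter> cantor_set \<in> null_sets \<mu>"
proof -
  have "{r} \<in> null_sets \<mu>" if r: "r \<in> cantor_set" for r
  proof -
    have sing: "{r} \<in> sets \<mu>" using r by (simp add: sets_iff)
    have "prob {r} \<le> (1 / 2) ^ n" for n
    proof -
      have "prob {r} \<le> prob {x \<in> cantor_set. \<bar>x - r\<bar> < 1 / 3 ^ n}"
        using r by (intro finite_measure_mono ball_in_sets) auto
      also have "\<dots> \<le> (1 / 2) ^ n"
        using prob_ball_le_power[OF r order_refl, of n] by (simp add: power_one_over)
      finally show ?thesis .
    qed
    moreover have "(\<lambda>n. (1 / 2 :: real) ^ n) \<longlonglongrightarrow> 0"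
      by (rule LIMSEQ_power_zero) simp
    ultimately have "prob {r} \<le> 0"
      by (intro LIMSEQ_le_const[of _ 0]) auto
    hence "prob {r} = 0"
      using measure_nonneg[of \<mu> "{r}"] by linarith
    thus ?thesis using sing by (simp add: emeasure_eq_measure null_sets_def)
  qed
  hence "(\<Union>r\<in>\<rat> \<inter> cantor_set. {r}) \<in> null_sets \<mu>"
    by (intro null_sets_UN' countable_Int1 countable_rat) auto
  thus ?thesis by simp
qed

lemma W_int_in_sets: "W_int \<psi> \<in> sets \<mu>"
  using W_int_measurable by (simp add: sets_eq)

lemma W_int_convergence:
  fixes \<psi> :: "real \<Rightarrow> real"
  assumes pos: "\<forall>t>0. \<psi> t > 0" and anti: "antimono_on {0<..} \<psi>"
    and sum: "summable (\<lambda>n. real n * (3 ^ n * \<psi> (3 ^ n)) powr log 3 2)"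
  shows "prob (W_int \<psi>) = 0"
proof -
  define A where "A n = (\<Union>r\<in>rationals_of_size n. {x \<in> cantor_set. \<bar>x - r\<bar> < \<psi> (q_int r)})" for n
  have A: "A n \<in> events" for n
    unfolding A_def using finite_rationals_of_size by (intro sets.finite_UN ball_in_sets)
  \<comment> \<open>The shift by one fits \<open>3 ^ n \<le> q_int r\<close> for \<open>r\<close> of
    size \<open>Suc n\<close>. The constant 8 is made of 2 from \<open>prob_ball_le\<close>, 2 from
    \<open>2 ^ Suc n\<close>, and 2 from \<open>Suc n \<le> 2 * n\<close>.\<close>
  have bound: "prob (A (Suc n)) \<le> 8 * (real n * (3 ^ n * \<psi> (3 ^ n)) powr log 3 2)" if "n \<ge> 1" for n
  proof -
    let ?e = "\<psi> (3 ^ n) powr log 3 2"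
    have "prob (A (Suc n)) \<le> (\<Sum>r\<in>rationals_of_size (Suc n). prob {x \<in> cantor_set. \<bar>x - r\<bar> < \<psi> (q_int r)})"
      unfolding A_def by (intro measure_UNION_le finite_rationals_of_size ball_in_sets)
    also have "\<dots> \<le> (\<Sum>r\<in>rationals_of_size (Suc n). 2 * ?e)"
    proof (rule sum_mono)
      fix r assume "r \<in> rationals_of_size (Suc n)"
      hence r: "r \<in> cantor_set" "r \<in> \<rat>"
          "prelength (cantor_digits r) + period (cantor_digits r) = Suc n"
        by (auto simp: rationals_of_size_def)
      have "3 ^ n \<le> q_int r"
        using q_int_bounds(2)[OF r(1,2)] r(3) by simp
      hence q: "3 ^ n \<le> real (q_int r)"
        using of_nat_mono[of "3 ^ n" "q_int r", where 'a = real] by simp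
      moreover have "(3::real) ^ n > 0" by simp
      ultimately have q0: "real (q_int r) > 0" by linarith
      have "\<psi> (q_int r) \<le> \<psi> (3 ^ n)"
        using q q0 by (intro monotone_onD[OF anti]) auto
      moreover have "\<psi> (q_int r) > 0" using pos q0 by blast
      moreover from this have "prob {x \<in> cantor_set. \<bar>x - r\<bar> < \<psi> (q_int r)} \<le> 2 * \<psi> (q_int r) powr log 3 2"
        by (rule prob_ball_le[OF r(1)])
      ultimately show "prob {x \<in> cantor_set. \<bar>x - r\<bar> < \<psi> (q_int r)} \<le> 2 * ?e"
        using powr_mono2[of "log 3 2" "\<psi> (q_int r)" "\<psi> (3 ^ n)"] by simp
    qed
    also have "\<dots> = real (card (rationals_of_size (Suc n))) * (2 * ?e)"
      by simp
    also have "\<dots> \<le> real (Suc n * 2 ^ Suc n) * (2 * ?e)"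
      by (rule mult_right_mono[OF of_nat_mono[OF card_rationals_of_size]]) simp
    also have "\<dots> = real (4 * Suc n) * (2 ^ n * ?e)"
      by (simp add: field_simps)
    also have "\<dots> \<le> (8 * real n) * (2 ^ n * ?e)"
      using that by (intro mult_right_mono) auto
    also have "2 ^ n * ?e = (3 ^ n * \<psi> (3 ^ n)) powr log 3 2"
      using powr_log_3_2[of n] pos by (simp add: powr_mult powr_divide field_simps)
    finally show ?thesis by (simp add: mult.assoc)
  qed
  have "summable (\<lambda>n. prob (A (Suc n)))"
    by (rule summable_comparison_test'[OF summable_mult[OF sum, of 8], where N = 1])
      (use bound in auto)
  hence "summable (\<lambda>n. prob (A n))"
    using summable_Suc_iff[of "\<lambda>n. prob (A n)"] by simp
  hence "AE x in \<mu>. eventually (\<lambda>n. x \<in> space \<mu> - A n) sequentially"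
    by (intro borel_cantelli_AE1 A) (auto simp: emeasure_eq_measure)
  hence "AE x in \<mu>. x \<notin> W_int \<psi>"
  proof eventually_elim
    case (elim x)
    then obtain N where N: "\<And>n. n \<ge> N \<Longrightarrow> x \<notin> A n"
      by (auto simp: eventually_sequentially)
    show ?case
    proof
      assume x: "x \<in> W_int \<psi>"
      \<comment> \<open>As \<open>x\<close> avoids every \<open>A n\<close> with
        \<open>n \<ge> N\<close>, its approximations have size below \<open>N\<close>, which leaves
        finitely many.\<close>
      have "{r \<in> \<rat> \<inter> cantor_set. \<bar>x - r\<bar> < \<psi> (q_int r)} \<subseteq> (\<Union>n<N. rationals_of_size n)"
      proof
        fix r assume r: "r \<in> {r \<in> \<rat> \<inter> cantor_set. \<bar>x - r\<bar> < \<psi> (q_int r)}"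
        define n where "n = prelength (cantor_digits r) + period (cantor_digits r)"
        have rn: "r \<in> rationals_of_size n" using r by (simp add: rationals_of_size_def n_def)
        hence "x \<in> A n" using r x by (auto simp: A_def W_int_def)
        with N have "n < N" using not_le by blast
        with rn show "r \<in> (\<Union>n<N. rationals_of_size n)" by blast
      qed
      moreover have "finite (\<Union>n<N. rationals_of_size n)"
        using finite_rationals_of_size by blast
      ultimately have "finite {r \<in> \<rat> \<inter> cantor_set. \<bar>x - r\<bar> < \<psi> (q_int r)}"
        by (rule finite_subset)
      thus False using x by (simp add: W_int_def)
    qed
  qed
  thus ?thesis
    using prob_eq_0[OF W_int_in_sets] by simp
qed

lemma W_int_divergence:
  fixes \<psi> :: "real \<Rightarrow> real"
  assumes pos: "\<forall>t>0. \<psi> t > 0" and anti: "antimono_on {0<..} \<psi>"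
    and div: "\<not> summable (\<lambda>n. real n * (3 ^ n * \<psi> (3 ^ n)) powr log 3 2)"
  shows "prob (W_int \<psi>) = 1"
proof -
  define k where "k n = (LEAST k. 1 / 3 ^ (n + k) < \<psi> (3 ^ n))" for n
  have k: "1 / 3 ^ (n + k n) < \<psi> (3 ^ n)" for n
  proof -
    have "\<psi> (3 ^ n) > 0" using pos by simp
    then obtain j where "(1 / 3) ^ j < \<psi> (3 ^ n)"
      using real_arch_pow_inv[of "\<psi> (3 ^ n)" "1 / 3"] by auto
    moreover have "(1 / 3 :: real) ^ (n + j) \<le> (1 / 3) ^ j"
      by (intro power_decreasing) auto
    ultimately have "1 / 3 ^ (n + j) < \<psi> (3 ^ n)"
      by (simp only: power_one_over)
    thus ?thesis unfolding k_def by (rule LeastI)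
  qed
  \<comment> \<open>For \<open>k n = 0\<close> minimality says nothing, and
    \<open>3 ^ n * \<psi> (3 ^ n)\<close> need not obey such a bound.\<close>
  have k_le: "(3 ^ n * \<psi> (3 ^ n)) powr log 3 2 \<le> 2 * (1 / 2) ^ k n" if "k n \<noteq> 0" for n
  proof -
    have "\<exists>j. k n = Suc j" using that by (rule not0_implies_Suc)
    then obtain j where j: "k n = Suc j" ..
    hence "\<psi> (3 ^ n) \<le> 1 / 3 ^ (n + j)"
      using not_less_Least[of j "\<lambda>k. 1 / 3 ^ (n + k) < \<psi> (3 ^ n)"] by (simp add: k_def not_less)
    hence "3 ^ n * \<psi> (3 ^ n) \<le> 1 / 3 ^ j"
      by (simp add: power_add field_simps)
    moreover have "3 ^ n * \<psi> (3 ^ n) \<ge> 0" using pos by (simp add: less_imp_le)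
    ultimately have "(3 ^ n * \<psi> (3 ^ n)) powr log 3 2 \<le> (1 / 3 ^ j) powr log 3 2"
      by (intro powr_mono2) auto
    also have "\<dots> = 2 * (1 / 2) ^ k n"
      by (subst powr_log_3_2) (simp add: j power_one_over)
    finally show ?thesis .
  qed
  have "\<not> summable (\<lambda>n. real n * (1 / 2) ^ k n)"
  proof
    assume s: "summable (\<lambda>n. real n * (1 / 2) ^ k n)"
    \<comment> \<open>This rules out \<open>k n = 0\<close> for large \<open>n\<close>, where the
      term would be \<open>n \<ge> 1\<close>.\<close>
    have "eventually (\<lambda>n. real n * (1 / 2) ^ k n < 1) sequentially"
      using summable_LIMSEQ_zero[OF s] by (rule order_tendstoD) simp
    moreover have "eventually (\<lambda>n. n \<ge> 1) sequentially"
      by (rule eventually_ge_at_top)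
    ultimately have "eventually (\<lambda>n. norm (real n * (3 ^ n * \<psi> (3 ^ n)) powr log 3 2) \<le>
        2 * (real n * (1 / 2) ^ k n)) sequentially"
    proof eventually_elim
      case (elim n)
      hence "k n \<noteq> 0" by (auto intro: ccontr)
      from mult_left_mono[OF k_le[OF this], of "real n"] show ?case
        by (simp add: mult_ac)
    qed
    hence "summable (\<lambda>n. real n * (3 ^ n * \<psi> (3 ^ n)) powr log 3 2)"
      by (rule summable_comparison_test_ev) (intro summable_mult s)
    with div show False ..
  qed
  hence "AE x in \<mu>. infinite {(n, l). l < n \<and> matches n l (k n) (cantor_digits x)}"
    by (rule infinitely_many_matches)
  moreover have "AE x in \<mu>. x \<notin> \<rat> \<inter> cantor_set"
    using rationals_null by (rule AE_not_in)
  ultimately have "AE x in \<mu>. x \<in> W_int \<psi>"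
    using AE_space
  proof eventually_elim
    case (elim x)
    define T where "T = {(n, l). l < n \<and> matches n l (k n) (cantor_digits x)}"
    define G where "G = {r \<in> \<rat> \<inter> cantor_set. \<bar>x - r\<bar> < \<psi> (real (q_int r))}"
    have x: "x \<in> cantor_set" "x \<notin> \<rat>" and T: "infinite T"
      using elim by (auto simp: space_eq T_def)
    \<comment> \<open>A finite \<open>G\<close> would keep a distance \<open>e\<close> from the
      irrational \<open>x\<close>. But infinitely many repetitions force arbitrarily large
      \<open>n\<close>, and their rationals are in \<open>G\<close> and closer than
      \<open>e\<close>.\<close>
    have "infinite G"
    proof
      assume "finite G"
      moreover have "x \<notin> G" using x by (auto simp: G_def)
      ultimately obtain e where e: "e > 0" "\<And>r. r \<in> G \<Longrightarrow> e \<le> \<bar>x - r\<bar>"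
        using finite_set_avoid[of G x] unfolding dist_real_def by metis
      obtain M where M: "(1 / 3) ^ M < e"
        using real_arch_pow_inv[of e "1 / 3"] e by auto
      have "\<not> T \<subseteq> {..M} \<times> {..M}"
        using T finite_subset by blast
      then obtain n l where nl: "l < n" "matches n l (k n) (cantor_digits x)" "n > M"
        unfolding T_def by fastforce
      then obtain r where r: "r \<in> \<rat> \<inter> cantor_set" "q_int r \<le> 3 ^ n" "\<bar>x - r\<bar> \<le> 1 / 3 ^ (n + k n)"
        using rational_approximation[OF x(1) nl(1), of "k n"] by (auto simp: matches_def)
      have "q_int r \<ge> 1"
        using q_int_bounds(2)[of r] r(1) by (metis IntE one_le_numeral one_le_power order_trans)
      hence "\<psi> (3 ^ n) \<le> \<psi> (real (q_int r))"
        using r(2) of_nat_mono[OF r(2), where 'a = real]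
        by (intro monotone_onD[OF anti]) auto
      hence "r \<in> G"
        using r k[of n] by (auto simp: G_def)
      hence "e \<le> 1 / 3 ^ (n + k n)" using e(2) r(3) by fastforce
      also have "\<dots> \<le> (1 / 3) ^ M"
        unfolding power_one_over[symmetric] using nl(3) by (intro power_decreasing) auto
      finally show False using M by simp
    qed
    thus ?case using x by (simp add: W_int_def G_def)
  qed
  thus ?thesis
    using prob_eq_1[OF W_int_in_sets] by simp
qed

end

section \<open>Hausdorff measures\<close>

lemma
  assumes "\<forall>i<n. b i \<in> {0, 2}"
  shows bounded_cylinder: "bounded (cantor_cylinder n b)"
    and diameter_cylinder: "diameter (cantor_cylinder n b) \<le> 1 / 3 ^ n"
proof -
  show "bounded (cantor_cylinder n b)"
    using compact_cantor_cylinder[OF assms] by (rule compact_imp_bounded)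
  show "diameter (cantor_cylinder n b) \<le> 1 / 3 ^ n"
  proof (rule diameter_le)
    fix x y assume "x \<in> cantor_cylinder n b" "y \<in> cantor_cylinder n b"
    thus "norm (x - y) \<le> 1 / 3 ^ n"
      unfolding real_norm_def cantor_cylinder_def
      by (intro cantor_expansion_agree[OF cantor_expansion_digits cantor_expansion_digits]) auto
  qed simp
qed

context cantor_measure
begin

text \<open>Outer regularity gives an open \<open>G\<close> around \<open>E\<close> with hardly more
  mass. Its part in the Cantor set is partitioned into the largest cylinders of level at least
  \<open>n0\<close> that fit into \<open>G\<close>.\<close>

lemma disjoint_cylinder_cover:
  assumes E: "E \<in> sets \<mu>" and "\<epsilon> > 0"
  shows "\<exists>U :: nat \<Rightarrow> real set. E \<subseteq> (\<Union>i. U i) \<and> disjoint_family U \<and> prob (\<Union>i. U i) \<le> prob E + \<epsilon> \<and>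
    (\<forall>i. U i = {} \<or> (\<exists>n b. n \<ge> n0 \<and> (\<forall>i<n. b i \<in> {0, 2}) \<and> U i = cantor_cylinder n b))"
proof -
  \<comment> \<open>Outer regularity is applied on the whole real line, hence the transport of \<mu>
    to \<open>borel\<close>.\<close>
  define \<nu> where "\<nu> = distr \<mu> borel id"
  have id: "id \<in> measurable \<mu> borel"
    unfolding measurable_def space_eq using borel_compact[OF compact_cantor_set]
    by (auto simp: sets_iff)
  have \<nu>: "emeasure \<nu> B = emeasure \<mu> (B \<inter> cantor_set)" if "B \<in> sets borel" for B
    unfolding \<nu>_def using id that by (subst emeasure_distr) (auto simp: space_eq)
  have EK: "E \<subseteq> cantor_set" "E \<in> sets borel" using E by (auto simp: sets_iff)
  have "(INF G \<in> {G. E \<subseteq> G \<and> open G}. emeasure \<nu> G) = emeasure \<nu> E"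
    using EK by (intro outer_regular[symmetric]) (auto simp: \<nu>_def emeasure_distr[OF id])
  also have "emeasure \<nu> E = ennreal (prob E)"
    using EK by (simp add: \<nu> Int_absorb2 emeasure_eq_measure)
  also have "\<dots> < ennreal (prob E + \<epsilon>)"
    using \<open>\<epsilon> > 0\<close> by (simp add: ennreal_less_iff)
  finally obtain G where G: "E \<subseteq> G" "open G" "emeasure \<nu> G < ennreal (prob E + \<epsilon>)"
    unfolding INF_less_iff by blast
  have "ennreal (prob (G \<inter> cantor_set)) < ennreal (prob E + \<epsilon>)"
    using G by (simp add: \<nu> emeasure_eq_measure)
  hence PG: "prob (G \<inter> cantor_set) \<le> prob E + \<epsilon>"
    by (simp add: ennreal_less_iff)
  define good where "good x n \<longleftrightarrow> n \<ge> n0 \<and> cantor_cylinder n (cantor_digits x) \<subseteq> G" for x n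
  define lv where "lv x = (LEAST n. good x n)" for x
  define cyl where "cyl x = cantor_cylinder (lv x) (cantor_digits x)" for x
  have good_lv: "good x (lv x)" if x: "x \<in> G \<inter> cantor_set" for x
  proof -
    obtain e where e: "e > 0" "ball x e \<subseteq> G"
      using G(2) x by (auto simp: open_contains_ball)
    obtain M where M: "(1 / 3) ^ M < e"
      using real_arch_pow_inv[of e "1 / 3"] e by auto
    have "cantor_cylinder (max M n0) (cantor_digits x) \<subseteq> ball x e"
    proof
      fix y assume y: "y \<in> cantor_cylinder (max M n0) (cantor_digits x)"
      hence "\<bar>x - y\<bar> \<le> 1 / 3 ^ M"
        using x by (intro cantor_expansion_agree[OF cantor_expansion_digits cantor_expansion_digits])
          (auto simp: cantor_cylinder_def)
      thus "y \<in> ball x e" using M by (simp add: dist_real_def power_one_over)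
    qed
    hence "good x (max M n0)" using e by (auto simp: good_def)
    thus ?thesis unfolding lv_def by (rule LeastI)
  qed
  have in_cyl: "x \<in> cyl x" if "x \<in> G \<inter> cantor_set" for x
    using that by (simp add: cyl_def cantor_cylinder_def)
  \<comment> \<open>\<open>x\<close> and \<open>y\<close> have the same cylinders up to level
    \<open>lv x\<close>, hence the same least good level. So any two of these cylinders coincide or
    are disjoint.\<close>
  have cyl_eq: "cyl y = cyl x" if x: "x \<in> G \<inter> cantor_set" and y: "y \<in> cyl x" for x y
  proof -
    have agree: "cantor_cylinder n (cantor_digits y) = cantor_cylinder n (cantor_digits x)" if "n \<le> lv x" for n
      using y that by (auto simp: cyl_def cantor_cylinder_def)
    have "good y (lv x)" using good_lv[OF x] agree[of "lv x"] by (simp add: good_def)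
    hence le: "lv y \<le> lv x" and "good y (lv y)"
      unfolding lv_def[of y] by (auto intro: Least_le LeastI)
    hence "good x (lv y)" using agree[OF le] by (simp add: good_def)
    hence "lv x \<le> lv y" unfolding lv_def[of x] by (rule Least_le)
    with le have "lv y = lv x" by simp
    thus ?thesis using agree by (simp add: cyl_def)
  qed
  define D where "D = cyl ` (G \<inter> cantor_set)"
  have cyl_G: "cyl x \<subseteq> G \<inter> cantor_set" if "x \<in> G \<inter> cantor_set" for x
    using good_lv[OF that] by (auto simp: good_def cyl_def cantor_cylinder_def)
  have UD: "\<Union>D = G \<inter> cantor_set"
    using cyl_G in_cyl by (fastforce simp: D_def)
  have disj: "C = C'" if "C \<in> D" "C' \<in> D" "z \<in> C" "z \<in> C'" for C C' z
    using that cyl_eq unfolding D_def by blast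
  have "countable D"
  proof (rule countable_subset)
    show "D \<subseteq> (\<Union>n. cantor_cylinder n ` words n)"
    proof
      fix C assume "C \<in> D"
      then obtain x where x: "x \<in> G \<inter> cantor_set" "C = cyl x" by (auto simp: D_def)
      have "C = cantor_cylinder (lv x) (restrict (cantor_digits x) {..<lv x})"
        by (auto simp: x cyl_def cantor_cylinder_def)
      thus "C \<in> (\<Union>n. cantor_cylinder n ` words n)"
        using restrict_digits_in_words x(1) by blast
    qed
    show "countable (\<Union>n. cantor_cylinder n ` words n)"
      by (rule countable_UN[OF countableI_type countable_finite]) simp
  qed
  then obtain g :: "real set \<Rightarrow> nat" where g: "inj_on g D"
    by (rule countableE)
  define U where "U i = \<Union>{C \<in> D. g C = i}" for i
  have U_cases: "U i = {} \<or> U i \<in> D" for i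
  proof (cases "\<exists>C\<in>D. g C = i")
    case True
    then obtain C where C: "C \<in> D" "g C = i" by blast
    hence "{C \<in> D. g C = i} = {C}" using inj_onD[OF g] by blast
    thus ?thesis using C by (simp add: U_def)
  next
    case False
    hence "{C \<in> D. g C = i} = {}" by blast
    thus ?thesis unfolding U_def by (simp only: Union_empty simp_thms)
  qed
  have UU: "(\<Union>i. U i) = G \<inter> cantor_set"
    unfolding UD[symmetric] by (auto simp: U_def)
  have "disjoint_family U"
    unfolding disjoint_family_on_def U_def using disj by blast
  moreover have "E \<subseteq> (\<Union>i. U i)" using UU G(1) EK by blast
  moreover have "prob (\<Union>i. U i) \<le> prob E + \<epsilon>" using PG by (simp add: UU)
  moreover have "U i = {} \<or> (\<exists>n b. n \<ge> n0 \<and> (\<forall>i<n. b i \<in> {0, 2}) \<and> U i = cantor_cylinder n b)" for i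
  proof -
    have "\<exists>n b. n \<ge> n0 \<and> (\<forall>i<n. b i \<in> {0, 2}) \<and> C = cantor_cylinder n b" if "C \<in> D" for C
    proof -
      from that obtain x where x: "x \<in> G \<inter> cantor_set" "C = cyl x" by (auto simp: D_def)
      show ?thesis
      proof (intro exI conjI)
        show "n0 \<le> lv x" using good_lv[OF x(1)] by (simp add: good_def)
        show "\<forall>i<lv x. cantor_digits x i \<in> {0, 2}" using cantor_digit_cases x(1) by blast
        show "C = cantor_cylinder (lv x) (cantor_digits x)" by (simp add: x(2) cyl_def)
      qed
    qed
    thus ?thesis using U_cases by blast
  qed
  ultimately show ?thesis by blast
qed

text \<open>The mass of a cylinder of level \<open>n\<close> is
  \<open>(1 / 3 ^ n) powr log 3 2\<close>, and its diameter is at most \<open>1 / 3 ^ n\<close>. So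
  at scales below \<open>r\<close> the monotone ratio bounds its weight by
  \<open>f r / r powr log 3 2\<close> times its mass, and masses of disjoint cylinders add
  up.\<close>

lemma hausdorff_measure_le_prob:
  assumes f: "\<forall>r>0. f r > 0" and mono: "mono_on {0<..} (\<lambda>r. f r / r powr log 3 2)"
    and E: "E \<in> sets \<mu>" and "r > 0"
  shows "hausdorff_measure f E \<le> ennreal (f r / r powr log 3 2 * prob E)"
  unfolding hausdorff_measure_def
proof (rule SUP_least)
  fix \<delta> :: real assume "\<delta> \<in> {0<..}"
  define c where "c = f r / r powr log 3 2"
  have c: "c > 0" using f \<open>r > 0\<close> by (simp add: c_def)
  \<comment> \<open>From level \<open>n0\<close> on, diameters are below \<delta>, as the premeasure
    demands, and below \<open>r\<close>, where the ratio is at most \<open>c\<close>.\<close>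
  obtain n0 where n0: "(1 / 3) ^ n0 < min \<delta> r"
    using real_arch_pow_inv[of "min \<delta> r" "1 / 3"] \<open>\<delta> \<in> {0<..}\<close> \<open>r > 0\<close> by auto
  have weight: "f d \<le> c / 2 ^ n" if "0 < d" "d \<le> 1 / 3 ^ n" "n \<ge> n0" for d n
  proof -
    have "(1 / 3 :: real) ^ n \<le> (1 / 3) ^ n0"
      using that by (intro power_decreasing) auto
    hence "d \<le> r" using that n0 by (simp add: power_one_over)
    hence "f d / d powr log 3 2 \<le> c"
      unfolding c_def using that \<open>r > 0\<close> by (intro mono_onD[OF mono]) auto
    hence "f d \<le> c * d powr log 3 2"
      using that by (simp add: field_simps)
    also have "\<dots> \<le> c * (1 / 3 ^ n) powr log 3 2"
      using that c by (intro mult_left_mono powr_mono2) auto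
    finally show ?thesis by (simp add: powr_log_3_2)
  qed
  show "hausdorff_premeasure f \<delta> E \<le> ennreal (f r / r powr log 3 2 * prob E)"
  proof (rule ennreal_le_epsilon)
    fix e :: real assume "e > 0"
    obtain U :: "nat \<Rightarrow> real set" where U: "E \<subseteq> (\<Union>i. U i)" "disjoint_family U"
        "prob (\<Union>i. U i) \<le> prob E + e / c"
        "\<And>i. U i = {} \<or> (\<exists>n b. n \<ge> n0 \<and> (\<forall>i<n. b i \<in> {0, 2}) \<and> U i = cantor_cylinder n b)"
      using disjoint_cylinder_cover[OF E divide_pos_pos[OF \<open>e > 0\<close> c], of n0] by blast
    have U_sets: "U i \<in> events" for i
      using U(4)[of i] cylinder_in_sets by auto
    have piece: "bounded (U i) \<and> diameter (U i) \<le> \<delta> \<and>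
        (if diameter (U i) = 0 then 0 else ennreal (f (diameter (U i)))) \<le> ennreal c * emeasure \<mu> (U i)" for i
      using U(4)[of i]
    proof
      assume "U i = {}"
      thus ?thesis using \<open>\<delta> \<in> {0<..}\<close> by simp
    next
      assume "\<exists>n b. n \<ge> n0 \<and> (\<forall>i<n. b i \<in> {0, 2}) \<and> U i = cantor_cylinder n b"
      then obtain n b where nb: "n \<ge> n0" "\<forall>i<n. b i \<in> {0, 2}" "U i = cantor_cylinder n b" by blast
      have bd: "bounded (U i)" and diam: "diameter (U i) \<le> 1 / 3 ^ n"
        using bounded_cylinder diameter_cylinder nb by auto
      have "(1 / 3 :: real) ^ n \<le> (1 / 3) ^ n0"
        using nb by (intro power_decreasing) auto
      hence "diameter (U i) \<le> \<delta>"
        using diam n0 by (simp add: power_one_over)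
      moreover have "ennreal (f (diameter (U i))) \<le> ennreal c * emeasure \<mu> (U i)" if "diameter (U i) \<noteq> 0"
      proof -
        have "diameter (U i) > 0"
          using diameter_ge_0[OF bd] that by simp
        from weight[OF this diam nb(1)] have "f (diameter (U i)) \<le> c * prob (U i)"
          using measure_cylinder[OF nb(2)] nb(3) by simp
        thus ?thesis
          using c by (simp add: emeasure_eq_measure ennreal_mult[symmetric] ennreal_leI)
      qed
      ultimately show ?thesis using bd by auto
    qed
    have "hausdorff_premeasure f \<delta> E \<le>
        (\<Sum>i. if diameter (U i) = 0 then 0 else ennreal (f (diameter (U i))))"
      unfolding hausdorff_premeasure_def using U(1) piece by (intro INF_lower) auto
    also have "\<dots> \<le> (\<Sum>i. ennreal c * emeasure \<mu> (U i))"
      using piece by (intro suminf_le) auto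
    also have "\<dots> = ennreal c * emeasure \<mu> (\<Union>i. U i)"
      using U(2) U_sets by (subst ennreal_suminf_cmult, subst suminf_emeasure) auto
    also have "\<dots> = ennreal (c * prob (\<Union>i. U i))"
      using c by (simp add: emeasure_eq_measure ennreal_mult)
    also have "\<dots> \<le> ennreal (c * (prob E + e / c))"
      using U(3) c by (intro ennreal_leI mult_left_mono) auto
    also have "c * (prob E + e / c) = f r / r powr log 3 2 * prob E + e"
      using c by (simp add: distrib_left flip: c_def)
    also have "ennreal \<dots> = ennreal (f r / r powr log 3 2 * prob E) + ennreal e"
      using c \<open>e > 0\<close> by (intro ennreal_plus) (auto simp flip: c_def)
    finally show "hausdorff_premeasure f \<delta> E \<le> ennreal (f r / r powr log 3 2 * prob E) + ennreal e" .
  qed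
qed

end

section \<open>Monotonicity and finite subadditivity of Hausdorff measures\<close>

lemma hausdorff_measure_mono: "A \<subseteq> B \<Longrightarrow> hausdorff_measure f A \<le> hausdorff_measure f B"
  unfolding hausdorff_measure_def hausdorff_premeasure_def
  by (intro SUP_mono' INF_superset_mono) auto

text \<open>Serves to merge two covering sequences into one, which
  \<open>hausdorff_premeasure\<close> asks for.\<close>

lemma suminf_interleave_le:
  fixes a b :: "nat \<Rightarrow> ennreal"
  shows "(\<Sum>i. if even i then a (i div 2) else b (i div 2)) \<le> (\<Sum>i. a i) + (\<Sum>i. b i)"
proof -
  let ?c = "\<lambda>i. if even i then a (i div 2) else b (i div 2)"
  have double: "(\<Sum>i<2 * N. ?c i) = (\<Sum>i<N. a i) + (\<Sum>i<N. b i)" for N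
    by (induction N) (auto simp: add_ac)
  show ?thesis
    unfolding suminf_eq_SUP[of ?c]
  proof (rule SUP_least)
    fix N
    have "(\<Sum>i<N. ?c i) \<le> (\<Sum>i<2 * N. ?c i)"
      by (rule sum_mono2) auto
    also have "\<dots> \<le> (\<Sum>i. a i) + (\<Sum>i. b i)"
      unfolding double by (intro add_mono sum_le_suminf) auto
    finally show "(\<Sum>i<N. ?c i) \<le> (\<Sum>i. a i) + (\<Sum>i. b i)" .
  qed
qed

text \<open>Covers of \<open>A\<close> and \<open>B\<close>, each within \<open>e / 2\<close> of the
  infimum, are interleaved at even and odd indices.\<close>

lemma hausdorff_premeasure_Un_le:
  "hausdorff_premeasure f \<delta> (A \<union> B) \<le> hausdorff_premeasure f \<delta> A + hausdorff_premeasure f \<delta> B"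
proof -
  define covers where "covers E = {U :: nat \<Rightarrow> 'a set. E \<subseteq> (\<Union>i. U i) \<and> (\<forall>i. bounded (U i) \<and> diameter (U i) \<le> \<delta>)}" for E
  define w where "w X = (if diameter X = 0 then 0 else ennreal (f (diameter X)))" for X :: "'a set"
  have pre: "hausdorff_premeasure f \<delta> E = (INF U \<in> covers E. \<Sum>i. w (U i))" for E
    by (simp add: hausdorff_premeasure_def covers_def w_def)
  have le: "hausdorff_premeasure f \<delta> (A \<union> B) \<le> (\<Sum>i. w (U i)) + (\<Sum>i. w (V i))"
    if "U \<in> covers A" "V \<in> covers B" for U V
  proof -
    define T where "T i = (if even i then U (i div 2) else V (i div 2))" for i
    have "U i \<subseteq> (\<Union>i. T i)" "V i \<subseteq> (\<Union>i. T i)" for i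
      using UN_upper[of "2 * i" UNIV T] UN_upper[of "2 * i + 1" UNIV T] by (auto simp: T_def)
    hence "A \<union> B \<subseteq> (\<Union>i. T i)"
      using that unfolding covers_def by blast
    moreover have "bounded (T i) \<and> diameter (T i) \<le> \<delta>" for i
      using that by (auto simp: covers_def T_def)
    ultimately have "T \<in> covers (A \<union> B)"
      unfolding covers_def by blast
    hence "hausdorff_premeasure f \<delta> (A \<union> B) \<le> (\<Sum>i. w (T i))"
      unfolding pre by (rule INF_lower)
    also have "\<dots> \<le> (\<Sum>i. w (U i)) + (\<Sum>i. w (V i))"
      using suminf_interleave_le[of "\<lambda>i. w (U i)" "\<lambda>i. w (V i)"] by (simp add: T_def if_distrib)
    finally show ?thesis .
  qed
  show ?thesis
  proof (rule ennreal_le_epsilon)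
    fix e :: real
    assume "e > 0" and fin: "hausdorff_premeasure f \<delta> A + hausdorff_premeasure f \<delta> B < top"
    hence e2: "0 < e / 2" by simp
    have fin': "hausdorff_premeasure f \<delta> A \<noteq> \<infinity>" "hausdorff_premeasure f \<delta> B \<noteq> \<infinity>"
      using fin by auto
    obtain U where U: "U \<in> covers A" "(\<Sum>i. w (U i)) < hausdorff_premeasure f \<delta> A + ennreal (e / 2)"
      using INF_approx_ennreal[OF e2 pre fin'(1)] by blast
    obtain V where V: "V \<in> covers B" "(\<Sum>i. w (V i)) < hausdorff_premeasure f \<delta> B + ennreal (e / 2)"
      using INF_approx_ennreal[OF e2 pre fin'(2)] by blast
    have "hausdorff_premeasure f \<delta> (A \<union> B) \<le> (\<Sum>i. w (U i)) + (\<Sum>i. w (V i))"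
      by (rule le[OF U(1) V(1)])
    also have "\<dots> \<le> (hausdorff_premeasure f \<delta> A + ennreal (e / 2)) + (hausdorff_premeasure f \<delta> B + ennreal (e / 2))"
      using U(2) V(2) by (intro add_mono less_imp_le)
    also have "\<dots> = hausdorff_premeasure f \<delta> A + hausdorff_premeasure f \<delta> B + (ennreal (e / 2) + ennreal (e / 2))"
      by (simp add: add_ac)
    also have "ennreal (e / 2) + ennreal (e / 2) = ennreal e"
      using \<open>e > 0\<close> by (simp flip: ennreal_plus)
    finally show "hausdorff_premeasure f \<delta> (A \<union> B) \<le>
        hausdorff_premeasure f \<delta> A + hausdorff_premeasure f \<delta> B + ennreal e" .
  qed
qed

lemma hausdorff_measure_Un_le:
  "hausdorff_measure f (A \<union> B) \<le> hausdorff_measure f A + hausdorff_measure f B"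
  unfolding hausdorff_measure_def[of f "A \<union> B"]
proof (rule SUP_least)
  fix \<delta> :: real assume "\<delta> \<in> {0<..}"
  hence "hausdorff_premeasure f \<delta> A \<le> hausdorff_measure f A"
    "hausdorff_premeasure f \<delta> B \<le> hausdorff_measure f B"
    unfolding hausdorff_measure_def by (auto intro: SUP_upper)
  hence "hausdorff_premeasure f \<delta> A + hausdorff_premeasure f \<delta> B \<le> hausdorff_measure f A + hausdorff_measure f B"
    by (rule add_mono)
  thus "hausdorff_premeasure f \<delta> (A \<union> B) \<le> hausdorff_measure f A + hausdorff_measure f B"
    by (rule order_trans[OF hausdorff_premeasure_Un_le])
qed

section \<open>The zero-one law and its transfer to Hausdorff measures\<close>

theorem theorem1p4:
  fixes \<psi> :: "real \<Rightarrow> real" and \<mu> :: "real measure" and \<gamma> :: real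
  assumes \<gamma>: "\<gamma> = log 3 2"
    and \<mu>: "is_cantor_measure \<mu>"
    and \<psi>_pos: "\<forall>t>0. \<psi> t > 0"
    and \<psi>_antimono: "antimono_on {0<..} \<psi>"
  shows
    "(summable (\<lambda>n. real n * (3 ^ n * \<psi> (3 ^ n)) powr \<gamma>) \<longrightarrow> measure \<mu> (W_int \<psi>) = 0) \<and>
     (\<not> summable (\<lambda>n. real n * (3 ^ n * \<psi> (3 ^ n)) powr \<gamma>) \<longrightarrow> measure \<mu> (W_int \<psi>) = 1) \<and>
     (\<forall>f. dimension_function f \<and> mono_on {0<..} (\<lambda>r. f r / r powr \<gamma>) \<longrightarrow>
        (\<not> summable (\<lambda>n. real n * 3 powr (real n * \<gamma>) * f (\<psi> (3 ^ n))) \<longrightarrow>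
           hausdorff_measure f (W_int \<psi>) = hausdorff_measure f cantor_set) \<and>
        (summable (\<lambda>n. real n * 3 powr (real n * \<gamma>) * f (\<psi> (3 ^ n))) \<longrightarrow>
           hausdorff_measure f (W_int \<psi>) = 0))"
proof -
  interpret prob_space \<mu> using \<mu> by (simp add: is_cantor_measure_def)
  interpret cantor_measure \<mu> by unfold_locales (rule \<mu>)
  let ?a = "\<lambda>n. real n * (3 ^ n * \<psi> (3 ^ n)) powr \<gamma>"
  have conv: "summable ?a \<Longrightarrow> prob (W_int \<psi>) = 0"
    using W_int_convergence[OF \<psi>_pos \<psi>_antimono] by (simp add: \<gamma>)
  have div: "\<not> summable ?a \<Longrightarrow> prob (W_int \<psi>) = 1"
    using W_int_divergence[OF \<psi>_pos \<psi>_antimono] by (simp add: \<gamma>)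
  have part2: "(\<not> summable (\<lambda>n. real n * 3 powr (real n * \<gamma>) * f (\<psi> (3 ^ n))) \<longrightarrow>
           hausdorff_measure f (W_int \<psi>) = hausdorff_measure f cantor_set) \<and>
        (summable (\<lambda>n. real n * 3 powr (real n * \<gamma>) * f (\<psi> (3 ^ n))) \<longrightarrow>
           hausdorff_measure f (W_int \<psi>) = 0)"
    if f: "dimension_function f" and mono: "mono_on {0<..} (\<lambda>r. f r / r powr \<gamma>)" for f
  proof -
    let ?b = "\<lambda>n. real n * 3 powr (real n * \<gamma>) * f (\<psi> (3 ^ n))"
    define g where "g r = f r / r powr \<gamma>" for r
    have f_pos: "\<forall>r>0. f r > 0" using f by (simp add: dimension_function_def)
    hence g_pos: "g r > 0" if "r > 0" for r using that by (simp add: g_def)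
    have g_mono: "g r \<le> g s" if "0 < r" "r \<le> s" for r s
      using monotone_onD[OF mono, of r s] that by (simp add: g_def)
    have le: "hausdorff_measure f E \<le> ennreal (g r * prob E)" if "E \<in> sets \<mu>" "r > 0" for E r
      using hausdorff_measure_le_prob[OF f_pos mono[unfolded \<gamma>] that] by (simp add: g_def \<gamma>)
    have null: "hausdorff_measure f E = 0" if "E \<in> sets \<mu>" "prob E = 0" for E
      using le[OF that(1), of 1] that(2) by simp
    have \<psi>n: "\<psi> (3 ^ n) > 0" for n using \<psi>_pos by simp
    \<comment> \<open>The two series differ termwise by a value of \<open>g\<close>, so bounds on
      \<open>g\<close> compare them.\<close>
    have b_eq: "?b n = ?a n * g (\<psi> (3 ^ n))" for n
    proof -
      have "3 powr (real n * \<gamma>) = (3 ^ n) powr \<gamma>"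
        by (simp add: powr_powr flip: powr_realpow)
      thus ?thesis using \<psi>n[of n] by (simp add: g_def powr_mult)
    qed
    have "hausdorff_measure f (W_int \<psi>) = hausdorff_measure f cantor_set" if "\<not> summable ?b"
    proof -
      \<comment> \<open>\<open>g (\<psi> 1)\<close> bounds all the factors, so divergence of
        \<open>?b\<close> forces that of \<open>?a\<close>. The complement of
        \<open>W_int \<psi>\<close> is then null for \<mu>, hence for the Hausdorff measure.\<close>
      have "\<psi> (3 ^ n) \<le> \<psi> 1" for n
        by (rule monotone_onD[OF \<psi>_antimono]) auto
      hence "?b n \<le> ?a n * g (\<psi> 1)" for n
        unfolding b_eq using \<psi>n by (intro mult_left_mono g_mono) auto
      moreover have "?b n \<ge> 0" for n
        unfolding b_eq using \<psi>n g_pos by (simp add: less_imp_le)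
      ultimately have "summable ?b" if "summable ?a"
        by (intro summable_comparison_test'[OF summable_mult2[OF that, of "g (\<psi> 1)"], where N = 0]) simp
      with \<open>\<not> summable ?b\<close> have "prob (W_int \<psi>) = 1" using div by blast
      hence "prob (space \<mu> - W_int \<psi>) = 0"
        using prob_compl[OF W_int_in_sets] by simp
      hence "hausdorff_measure f (cantor_set - W_int \<psi>) = 0"
        using null[of "cantor_set - W_int \<psi>"] sets.compl_sets[OF W_int_in_sets[of \<psi>]]
        by (simp add: space_eq)
      moreover have W: "W_int \<psi> \<subseteq> cantor_set" by (auto simp: W_int_def)
      ultimately have "hausdorff_measure f cantor_set \<le> hausdorff_measure f (W_int \<psi>)"
        using hausdorff_measure_Un_le[of f "W_int \<psi>" "cantor_set - W_int \<psi>"]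
        by (simp add: Un_absorb1)
      thus ?thesis using hausdorff_measure_mono[OF W] by (rule antisym[rotated])
    qed
    moreover have "hausdorff_measure f (W_int \<psi>) = 0" if "summable ?b"
    \<comment> \<open>A positive lower bound on \<open>g\<close> makes \<open>?a\<close> converge
      with \<open>?b\<close>. Without one, \<open>g r\<close> becomes arbitrarily small, and
      \<open>le\<close> alone gives Hausdorff measure 0.\<close>
    proof (cases "\<exists>L>0. \<forall>r>0. L \<le> g r")
      case True
      then obtain L where L: "L > 0" "\<And>r. r > 0 \<Longrightarrow> L \<le> g r" by blast
      have "norm (?a n) \<le> ?b n / L" for n
      proof -
        have "?a n * L \<le> ?a n * g (\<psi> (3 ^ n))"
          using L(2)[OF \<psi>n] by (intro mult_left_mono) auto
        thus ?thesis unfolding b_eq using L(1) by (simp add: field_simps)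
      qed
      hence "summable ?a"
        by (rule summable_comparison_test'[OF summable_divide[OF that], where N = 0])
      thus ?thesis using conv null W_int_in_sets by blast
    next
      case False
      have "hausdorff_measure f (W_int \<psi>) \<le> 0 + ennreal e" if "e > 0" for e
      proof -
        obtain r where r: "r > 0" "g r < e" using False \<open>e > 0\<close> by (auto simp: not_le)
        have "g r * prob (W_int \<psi>) \<le> g r * 1"
          using g_pos[OF r(1)] by (intro mult_left_mono) auto
        hence "ennreal (g r * prob (W_int \<psi>)) \<le> ennreal e"
          using r(2) by (intro ennreal_leI) linarith
        with le[OF W_int_in_sets r(1), of \<psi>] show ?thesis
          by simp
      qed
      hence "hausdorff_measure f (W_int \<psi>) \<le> 0"
        by (rule ennreal_le_epsilon)
      thus ?thesis by simp
    qed
    ultimately show ?thesis by blast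
  qed
  have "\<forall>f. dimension_function f \<and> mono_on {0<..} (\<lambda>r. f r / r powr \<gamma>) \<longrightarrow>
        (\<not> summable (\<lambda>n. real n * 3 powr (real n * \<gamma>) * f (\<psi> (3 ^ n))) \<longrightarrow>
           hausdorff_measure f (W_int \<psi>) = hausdorff_measure f cantor_set) \<and>
        (summable (\<lambda>n. real n * 3 powr (real n * \<gamma>) * f (\<psi> (3 ^ n))) \<longrightarrow>
           hausdorff_measure f (W_int \<psi>) = 0)"
    by (intro allI impI) (elim conjE, rule part2)
  thus ?thesis by (intro conjI impI conv div)
qed

end
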